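(* Let $h_0\in L^\infty(\mathbb{R})$ be nonnegative and such that the function $$m_0(\theta):=\sum_{k\in\mathbb{Z}}e^{\alpha(k+\theta)}h_0(k+\theta),\qquad \theta\in[0,1),$$ belongs to $L^1(0,1)$. Let $h$ be the solution of $$\partial_t h(t,x)=\partial_x h(t,x)+\alpha h(t,x)+e^{-\alpha}h^2(t,x-1)-h^2(t,x),\qquad t>0,\ x\in\mathbb{R},$$ with initial condition $h(0,\cdot)=h_0$. Define $$\mu(t,x):=\frac{\ln\big(m_0(\Theta(t,x))\big)}{\alpha},\qquad (t,x)\in(0,\infty)\times\mathbb{R},$$ where $\Theta(t,x)=t+x-\lfloor t+x\rfloor$. Then $$\lim_{t\to\infty}\int_{\mathbb{R}}e^{\alpha x}\,\Big|h(t,x)-\bar h\big(x-\mu(t,x)\big)\Big|\,dx=0 .$$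
   Context: Let $\gamma<1$ and $\alpha:=(1-\gamma)\ln 2>0$. Solution of the evolution equation: fixing a nonnegative bounded representative of $h_0$, the solution $h$ is the nonnegative function on $[0,\infty)\times\mathbb{R}$, bounded on $[0,T]\times\mathbb{R}$ for every $T>0$, with $h(0,\cdot)=h_0$, that satisfies the equation along characteristics: for every $y\in\mathbb{R}$ the function $t\mapsto h(t,y-t)$ is $C^1$ on $[0,\infty)$ and $$\frac{d}{dt}\big[h(t,y-t)\big]=\alpha h(t,y-t)+e^{-\alpha}h^2(t,y-t-1)-h^2(t,y-t).$$ The profile $\bar h$: $\bar h\in C^1(\mathbb{R})\cap L^1(\mathbb{R};e^{\alpha x}dx)$ is a fixed nonnegative solution of the stationary equation $$0=\partial_x\bar h(x)+\alpha\bar h(x)+e^{-\alpha}\bar h^2(x-1)-\bar h^2(x),\qquad x\in\mathbb{R},$$ with $\int_{\mathbb{R}}e^{\alpha x}\bar h(x)\,dx=1$, such that for some $a>0$ $$\lim_{x\to-\infty}2^{-\sigma x}\Big(\bar h(x)-\frac{\alpha}{1-e^{-\alpha}}\Big)=-a,$$ where $\sigma$ is the only positive root of $\big(1+\frac{\sigma\ln 2}{\alpha}\big)(1-e^{-\alpha})=2(1-e^{-\alpha}2^{-\sigma})$, and such that $0<\bar h(x)\le C\exp(-L2^x)$ for all $x\in\mathbb{R}$, for some constants $C,L>0$. (The existence of such a profile is known.) Convention: where $m_0(\Theta(t,x))=0$, so that $\mu(t,x)=-\infty$, the value $\bar h(x-\mu(t,x))$ is understood as $\lim_{z\to+\infty}\bar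 h(z)=0$. *)

theory Defs
  imports "HOL-Analysis.Analysis"
begin

text \<open>
  The sum over the integers has nonnegative terms and may diverge on a null set of \<open>\<theta>\<close>;
  it is taken in \<^typ>\<open>ennreal\<close>, so that divergence is recorded as \<open>\<infinity>\<close>.
\<close>

definition m0 :: "real \<Rightarrow> (real \<Rightarrow> real) \<Rightarrow> real \<Rightarrow> ennreal" where
  "m0 \<alpha> h0 \<theta> =
     (\<integral>\<^sup>+ k. ennreal (exp (\<alpha> * (of_int k + \<theta>)) * h0 (of_int k + \<theta>))
        \<partial>count_space (UNIV :: int set))"

definition \<mu> :: "real \<Rightarrow> (real \<Rightarrow> real) \<Rightarrow> real \<Rightarrow> real \<Rightarrow> ereal" where
  "\<mu> \<alpha> h0 t x =
     (let m = m0 \<alpha> h0 (frac (t + x)) in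
      if m = 0 then -\<infinity> else if m = \<infinity> then \<infinity> else ereal (ln (enn2real m) / \<alpha>))"

text \<open>
  Extension of a profile to the extended reals by its limits. The value at \<open>\<infinity>\<close>, which is \<open>0\<close> for
  the profiles below, is used where \<^const>\<open>m0\<close> vanishes; the value at \<open>-\<infinity>\<close> is used only where
  \<^const>\<open>m0\<close> is infinite, i.e. on a null set.
\<close>

definition profile_ext :: "(real \<Rightarrow> real) \<Rightarrow> ereal \<Rightarrow> real" where
  "profile_ext hb z =
     (case z of ereal r \<Rightarrow> hb r | PInfty \<Rightarrow> Lim at_top hb | MInfty \<Rightarrow> Lim at_bot hb)"

text \<open>
  The equation along characteristics. The derivative is one-sided at \<open>t = 0\<close>; values of \<open>h\<close> at
  negative times are irrelevant.
\<close>

definition evol_rhs :: "real \<Rightarrow> (real \<Rightarrow> real \<Rightarrow> real) \<Rightarrow> real \<Rightarrow> real \<Rightarrow> real" where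
  "evol_rhs \<alpha> h y t =
     \<alpha> * h t (y - t) + exp (- \<alpha>) * (h t (y - t - 1))\<^sup>2 - (h t (y - t))\<^sup>2"

definition evol_solution :: "real \<Rightarrow> (real \<Rightarrow> real) \<Rightarrow> (real \<Rightarrow> real \<Rightarrow> real) \<Rightarrow> bool" where
  "evol_solution \<alpha> h0 h \<longleftrightarrow>
     (\<forall>t\<ge>0. \<forall>x. 0 \<le> h t x) \<and>
     (\<forall>T>0. bounded {h t x |t x. 0 \<le> t \<and> t \<le> T}) \<and>
     (\<forall>x. h 0 x = h0 x) \<and>
     (\<forall>y. continuous_on {0..} (evol_rhs \<alpha> h y) \<and>
          (\<forall>t\<ge>0. ((\<lambda>s. h s (y - s)) has_real_derivative evol_rhs \<alpha> h y t) (at t within {0..})))"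

text \<open>
  The equation for \<open>\<sigma>\<close> has exactly one positive root: the difference of its two sides is convex
  in \<open>\<sigma>\<close>, negative at \<open>0\<close> and tends to infinity. Hence \<open>\<exists>\<sigma>>0\<close> refers to that root.
\<close>

definition stationary_profile :: "real \<Rightarrow> (real \<Rightarrow> real) \<Rightarrow> bool" where
  "stationary_profile \<alpha> hb \<longleftrightarrow>
     hb C1_differentiable_on UNIV \<and>
     (\<forall>x. 0 = deriv hb x + \<alpha> * hb x + exp (- \<alpha>) * (hb (x - 1))\<^sup>2 - (hb x)\<^sup>2) \<and>
     has_bochner_integral lebesgue (\<lambda>x. exp (\<alpha> * x) * hb x) 1 \<and>
     (\<exists>\<sigma>>0. (1 + \<sigma> * ln 2 / \<alpha>) * (1 - exp (- \<alpha>)) = 2 * (1 - exp (- \<alpha>) * 2 powr (- \<sigma>)) \<and>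
        (\<exists>a>0. ((\<lambda>x. 2 powr (- \<sigma> * x) * (hb x - \<alpha> / (1 - exp (- \<alpha>)))) \<longlongrightarrow> - a) at_bot)) \<and>
     (\<exists>C>0. \<exists>L>0. \<forall>x. 0 < hb x \<and> hb x \<le> C * exp (- L * 2 powr x))"

end

theory Submission
  imports Defs
begin

text \<open>
  Why the theorem holds. Fix \<open>\<theta>\<close> and follow the characteristics \<open>x = k + \<theta> - t\<close> with \<open>k\<close> an integer.
  The weighted values \<open>f k t = exp (\<alpha> * x) * h t x\<close> solve a discrete conservation law
  \<open>f k' = \<phi> (k - 1) - \<phi> k\<close> with flux \<open>\<phi> k = exp (- \<alpha> * x) * (f k)\<^sup>2\<close>, so that each lattice
  \<open>\<int> + \<theta>\<close> evolves on its own and cannot gain mass beyond its initial mass \<open>M = m0 \<alpha> h0 \<theta>\<close>.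
  The translate of the profile by \<open>ln M / \<alpha>\<close> solves the same system, and its mass on every lattice is
  exactly \<open>M\<close>. Hence the claim is that two solutions on a lattice approach each other in \<open>\<ell>\<^sup>1\<close>;
  dominated convergence in \<open>\<theta>\<close>, with the bound \<open>2 * m0 \<alpha> h0 \<theta>\<close>, then gives the theorem.

  On one lattice of finite positive mass, pass to the left sums \<open>U k = (\<Sum>j<k. f j)\<close>. They satisfy the upwind equation
  \<open>U k' = - c k t * (U k - U (k - 1))\<^sup>2\<close> with \<open>c k t = exp (\<alpha> * t) * exp (- \<alpha> * (k + \<theta> - 1))\<close>.
  It has three properties that together force convergence: it obeys a comparison principle
  (\<open>cumulative_comparison\<close>), adding a constant to a solution gives a solution, and it is autonomous in
  the time variable \<open>exp (\<alpha> * t)\<close>, so that the self-similar solution may be started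
  earlier or later. A translation in \<open>exp (\<alpha> * t)\<close> becomes invisible as \<open>t\<close> grows
  (\<open>clock_asymp\<close>). If the clock of the self-similar solution is far ahead, its
  mass sits at large \<open>k\<close> and its initial left sums exceed those of \<open>U\<close> by at most \<open>\<epsilon>\<close>; if its clock is
  far behind, they fall short of those of \<open>U\<close> by at most \<open>\<epsilon>\<close>. Comparison preserves both inequalities (\<open>V_le_U\<close>, \<open>U_le_V\<close>), and so the left
  sums converge uniformly (\<open>U_uniformly_close\<close>). Since the solution has at most the mass \<open>M\<close> of the wave,
  and almost all of the mass of the wave sits in a window of bounded length, uniform convergence of the left
  sums gives convergence in \<open>\<ell>\<^sup>1\<close> (\<open>lattice_l1_distance_le\<close>, \<open>lattice_convergence\<close>).

  That the profile has the same mass on every lattice follows from the same left sums: \<open>Q\<close> is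
  nondecreasing, so its limits along all lattices agree (\<open>lattice_mass\<close>). Measurability of
  \<open>h t\<close> is not part of the definition of a solution; it is obtained by exhibiting
  \<open>h t\<close> as a pointwise limit of Euler approximations (\<open>h_measurable\<close>).
\<close>

section \<open>Comparison for upwind systems\<close>

text \<open>
  After its last nonnegative time before \<open>t\<close> the function would be negative, hence, by the
  differential inequality, nondecreasing, and so it could not become negative.
\<close>

lemma nonneg_if_deriv_ge:
  fixes d d' a :: "real \<Rightarrow> real"
  assumes der: "\<And>t. t \<in> {0..T} \<Longrightarrow> (d has_real_derivative d' t) (at t within {0..T})"
    and ge: "\<And>t. t \<in> {0..T} \<Longrightarrow> - a t * d t \<le> d' t"
    and a: "\<And>t. t \<in> {0..T} \<Longrightarrow> 0 \<le> a t"
    and init: "0 \<le> d 0" and t: "t \<in> {0..T}"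
  shows "0 \<le> d t"
proof (rule ccontr)
  assume neg: "\<not> 0 \<le> d t"
  have cont: "continuous_on {0..t} d"
    by (rule DERIV_continuous_on, rule DERIV_subset, rule der) (use t in auto)
  let ?S = "{s \<in> {0..t}. d s \<in> {0..}}"
  have "closed ?S"
    using continuous_closed_preimage[OF cont, of "{0..}"] by (simp add: vimage_def Int_def)
  moreover have ne: "?S \<noteq> {}" using init t by (auto intro!: exI[of _ 0])
  moreover have bdd: "bdd_above ?S" by (rule bdd_aboveI[of _ t]) auto
  ultimately have S: "Sup ?S \<in> ?S" by (intro closed_contains_Sup) auto
  define s where "s = Sup ?S"
  have s: "0 \<le> s" "s \<le> t" "0 \<le> d s" using S by (auto simp: s_def)
  then have "s < t" using neg by (cases "s = t") auto
  have negd: "d r < 0" if "r \<in> {s<..<t}" for r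
  proof (rule ccontr)
    assume "\<not> d r < 0"
    then have "r \<in> ?S" using that s by auto
    then have "r \<le> s" unfolding s_def using bdd by (rule cSup_upper)
    then show False using that by auto
  qed
  have "\<exists>r\<in>{s<..<t}. d t - d s = (*) (d' r) (t - s)"
  proof (rule mvt_simple[OF \<open>s < t\<close>])
    fix r assume "s \<le> r" "r \<le> t"
    then show "(d has_derivative (*) (d' r)) (at r within {s..t})"
      unfolding has_field_derivative_def[symmetric]
      by (intro DERIV_subset[OF der]) (use s t in auto)
  qed
  then obtain r where r: "r \<in> {s<..<t}" "d t - d s = d' r * (t - s)" by auto
  have "0 \<le> a r * (- d r)" using negd[OF r(1)] a[of r] r(1) s t by (intro mult_nonneg_nonneg) auto
  then have "0 \<le> d' r" using ge[of r] r(1) s t by auto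
  then have "d s \<le> d t" using r \<open>s < t\<close> by (smt (verit) mult_nonneg_nonneg)
  then show False using s neg by simp
qed

text \<open>
  The difference \<open>d k = u k - v k + \<epsilon>\<close> satisfies the linear equation \<open>d k' = - a k * (d k - d (k - 1))\<close>
  with \<open>a k \<ge> 0\<close>, because \<open>d k - d (k - 1)\<close> is a difference of increments and the difference of their
  squares factors. Information only comes from the left neighbour, so nonnegativity propagates
  to the right by induction on \<open>k\<close>. It starts far to the left, where \<open>v k \<le> u k + \<epsilon>\<close> is
  assumed on each bounded time interval; this is where the margin \<open>\<epsilon>\<close> helps, since left sums
  vanish there uniformly.
\<close>

lemma cumulative_comparison:
  fixes u v c :: "int \<Rightarrow> real \<Rightarrow> real"
  assumes u: "\<And>k t. 0 \<le> t \<Longrightarrow>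
      (u k has_real_derivative - c k t * (u k t - u (k - 1) t)\<^sup>2) (at t within {0..})"
    and v: "\<And>k t. 0 \<le> t \<Longrightarrow>
      (v k has_real_derivative - c k t * (v k t - v (k - 1) t)\<^sup>2) (at t within {0..})"
    and c: "\<And>k t. 0 \<le> c k t"
    and umono: "\<And>k t. 0 \<le> t \<Longrightarrow> u (k - 1) t \<le> u k t"
    and vmono: "\<And>k t. 0 \<le> t \<Longrightarrow> v (k - 1) t \<le> v k t"
    and left: "\<And>T. \<exists>K. \<forall>k\<le>K. \<forall>t\<in>{0..T}. v k t \<le> u k t + \<epsilon>"
    and init: "\<And>k. v k 0 \<le> u k 0 + \<epsilon>"
    and t: "0 \<le> t"
  shows "v k t \<le> u k t + \<epsilon>"
proof -
  obtain K where K: "\<And>k s. k \<le> K \<Longrightarrow> s \<in> {0..t} \<Longrightarrow> v k s \<le> u k s + \<epsilon>"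
    using left[of t] by blast
  have "\<forall>s\<in>{0..t}. v k s \<le> u k s + \<epsilon>" if "K \<le> k" for k
    using that
  proof (induction k rule: int_ge_induct)
    case base
    then show ?case using K by auto
  next
    case (step k)
    let ?k = "k + 1"
    define a where "a s = c ?k s * ((u ?k s - u k s) + (v ?k s - v k s))" for s
    have "0 \<le> u ?k s - v ?k s + \<epsilon>" if s: "s \<in> {0..t}" for s
    proof (rule nonneg_if_deriv_ge[where a = a and T = t and
          d = "\<lambda>s. u ?k s - v ?k s + \<epsilon>" and
          d' = "\<lambda>s. - c ?k s * (u ?k s - u k s)\<^sup>2 - - c ?k s * (v ?k s - v k s)\<^sup>2 + 0"])
      fix s assume s: "s \<in> {0..t}"
      show "((\<lambda>s. u ?k s - v ?k s + \<epsilon>) has_real_derivative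
          (- c ?k s * (u ?k s - u k s)\<^sup>2 - - c ?k s * (v ?k s - v k s)\<^sup>2 + 0)) (at s within {0..t})"
        using DERIV_subset[OF u[of s ?k], of "{0..t}"] DERIV_subset[OF v[of s ?k], of "{0..t}"] s
        by (intro derivative_intros) auto
      show a0: "0 \<le> a s" unfolding a_def
        using c[of ?k s] umono[of s ?k] vmono[of s ?k] s by simp
      have "0 \<le> a s * (u k s - v k s + \<epsilon>)"
        using a0 bspec[OF step.IH s] by (intro mult_nonneg_nonneg) auto
      moreover have "- c ?k s * (u ?k s - u k s)\<^sup>2 - - c ?k s * (v ?k s - v k s)\<^sup>2 + 0
          = a s * (u k s - v k s + \<epsilon>) - a s * (u ?k s - v ?k s + \<epsilon>)"
        unfolding a_def by (simp add: algebra_simps power2_eq_square)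
      ultimately show "- a s * (u ?k s - v ?k s + \<epsilon>)
          \<le> - c ?k s * (u ?k s - u k s)\<^sup>2 - - c ?k s * (v ?k s - v k s)\<^sup>2 + 0" by simp
    qed (use init[of ?k] that in auto)
    then show ?case by (auto simp: algebra_simps)
  qed
  then show ?thesis using K[of k t] t by (cases "K \<le> k") auto
qed

text \<open>
  The partial sums of a spatially discrete conservation law have a derivative that telescopes to the
  two boundary fluxes. The one at infinity decays geometrically, which justifies differentiating
  term by term.
\<close>

lemma telescoping_series_derivative:
  fixes g p :: "nat \<Rightarrow> real \<Rightarrow> real"
  assumes S: "convex S" "x \<in> S"
    and der: "\<And>n x. x \<in> S \<Longrightarrow> (g n has_real_derivative p (Suc n) x - p n x) (at x within S)"
    and p: "\<And>n x. x \<in> S \<Longrightarrow> \<bar>p n x\<bar> \<le> C * q ^ n"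
    and g: "\<And>n x. x \<in> S \<Longrightarrow> \<bar>g n x\<bar> \<le> D * q ^ n"
    and q: "0 \<le> q" "q < 1"
  shows "((\<lambda>x. \<Sum>n. g n x) has_real_derivative - p 0 x) (at x within S)"
proof -
  have tel: "(\<Sum>i<n. p (Suc i) x - p i x) = p n x - p 0 x" for n x
    by (induction n) auto
  have q0: "(\<lambda>n. C * q ^ n) \<longlonglongrightarrow> 0"
    using q by (intro tendsto_mult_right_zero LIMSEQ_power_zero) auto
  have ul: "uniform_limit S (\<lambda>n x. \<Sum>i<n. p (Suc i) x - p i x) (\<lambda>x. - p 0 x) sequentially"
  proof (rule uniform_limitI)
    fix e :: real assume "0 < e"
    then have "\<forall>\<^sub>F n in sequentially. C * q ^ n < e" using q0 by (intro order_tendstoD)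
    then show "\<forall>\<^sub>F n in sequentially. \<forall>x\<in>S. dist (\<Sum>i<n. p (Suc i) x - p i x) (- p 0 x) < e"
      by eventually_elim (use p in \<open>auto simp: tel dist_real_def intro: le_less_trans\<close>)
  qed
  have sm: "summable (\<lambda>n. g n y)" if "y \<in> S" for y
    by (rule summable_comparison_test'[of "\<lambda>n. D * q ^ n" 0])
      (use g[OF that] q in \<open>auto intro!: summable_mult summable_geometric\<close>)
  obtain G where G: "\<forall>x\<in>S. (\<lambda>n. g n x) sums G x \<and> (G has_real_derivative - p 0 x) (at x within S)"
    using has_field_derivative_series[OF S(1) der ul S(2) sm[OF S(2)]] by auto
  have eq: "G y = (\<Sum>n. g n y)" if "y \<in> S" for y
    using G that by (auto simp: sums_iff)
  have "(G has_real_derivative - p 0 x) (at x within S)" using G S by auto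
  then show ?thesis
    by (rule has_field_derivative_transform_within[OF _ zero_less_one S(2)]) (use eq in auto)
qed

section \<open>Sums over half lattices\<close>

text \<open>
  Cumulative mass on the lattice \<open>\<int> + z\<close>. The point \<open>z\<close> itself is left out, so that the step from \<open>z\<close> to
  \<open>z + 1\<close> adds exactly \<open>w z\<close>.
\<close>

definition left_sum :: "(real \<Rightarrow> real) \<Rightarrow> real \<Rightarrow> real" where
  "left_sum w z = (\<Sum>n. w (z - 1 - real n))"

lemma exp_geometric: "exp (a * (z - 1 - real n)) = exp (a * (z - 1)) * exp (- a) ^ n" for a :: real
  by (simp add: algebra_simps flip: exp_of_nat_mult exp_add)

lemma summable_lattice:
  fixes w :: "real \<Rightarrow> real"
  assumes "0 < \<alpha>" and w: "\<And>x. 0 \<le> w x" "\<And>x. w x \<le> B * exp (\<alpha> * x)"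
  shows "summable (\<lambda>n. w (z - 1 - real n))"
proof (rule summable_comparison_test'[of _ 0])
  show "summable (\<lambda>n. B * (exp (\<alpha> * (z - 1)) * exp (- \<alpha>) ^ n))"
    using assms(1) by (intro summable_mult summable_geometric) auto
qed (use w in \<open>simp flip: exp_geometric\<close>)

lemma left_sum_nonneg:
  assumes "0 < \<alpha>" and "\<And>x. 0 \<le> w x" "\<And>x. w x \<le> B * exp (\<alpha> * x)"
  shows "0 \<le> left_sum w z"
  unfolding left_sum_def using assms by (intro suminf_nonneg summable_lattice[of \<alpha>]) auto

lemma left_sum_step:
  assumes "0 < \<alpha>" and "\<And>x. 0 \<le> w x" "\<And>x. w x \<le> B * exp (\<alpha> * x)"
  shows "left_sum w (z + 1) = left_sum w z + w z"
  unfolding left_sum_def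
  using suminf_split_head[OF summable_lattice[OF assms, of "z + 1"]]
  by (simp add: algebra_simps)

lemma left_sum_le:
  assumes \<alpha>: "0 < \<alpha>" and w: "\<And>x. 0 \<le> w x" "\<And>x. w x \<le> B * exp (\<alpha> * x)"
  shows "left_sum w z \<le> B / (exp \<alpha> - 1) * exp (\<alpha> * z)"
proof -
  have "left_sum w z \<le> (\<Sum>n. B * exp (\<alpha> * (z - 1)) * exp (- \<alpha>) ^ n)"
    unfolding left_sum_def
    using w(2) \<alpha> by (intro suminf_le summable_lattice[OF assms] summable_mult summable_geometric)
      (auto simp: mult.assoc simp flip: exp_geometric)
  also have "\<dots> = B * exp (\<alpha> * (z - 1)) * (1 / (1 - exp (- \<alpha>)))"
    using \<alpha> by (subst suminf_mult) (auto simp: suminf_geometric)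
  also have "\<dots> = B / (exp \<alpha> - 1) * exp (\<alpha> * z)"
    using \<alpha> by (simp add: field_simps exp_diff exp_minus)
  finally show ?thesis .
qed

lemma nn_integral_int_shift:
  "(\<integral>\<^sup>+ k. f (k + j) \<partial>count_space UNIV) = (\<integral>\<^sup>+ k. f k \<partial>count_space (UNIV :: int set))"
  by (rule nn_integral_bij_count_space) (rule bij_betw_byWitness[of _ "\<lambda>k. k - j"], auto)

text \<open>
  Left sums are computed as real series, lattice masses as integrals in
  \<^typ>\<open>ennreal\<close>, since the latter may diverge; this is the bridge between the two.
\<close>

lemma left_sum_eq_nn_integral:
  assumes "0 < \<alpha>" and w: "\<And>x. 0 \<le> w x" "\<And>x. w x \<le> B * exp (\<alpha> * x)"
  shows "ennreal (left_sum w (of_int k + z)) =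
    (\<integral>\<^sup>+ j. ennreal (w (of_int j + z)) * indicator {..<k} j \<partial>count_space UNIV)"
proof -
  have bij: "bij_betw (\<lambda>n. k - 1 - int n) UNIV {..<k}"
    by (rule bij_betw_byWitness[of _ "\<lambda>j. nat (k - 1 - j)"]) auto
  have "(\<integral>\<^sup>+ j. ennreal (w (of_int j + z)) * indicator {..<k} j \<partial>count_space UNIV)
      = (\<integral>\<^sup>+ j. ennreal (w (of_int j + z)) \<partial>count_space {..<k})"
    by (subst nn_integral_count_space_indicator) auto
  also have "\<dots> = (\<integral>\<^sup>+ n. ennreal (w (of_int (k - 1 - int n) + z)) \<partial>count_space UNIV)"
    by (rule nn_integral_bij_count_space[OF bij, symmetric])
  also have "\<dots> = (\<Sum>n. ennreal (w (of_int k + z - 1 - real n)))"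
    by (subst nn_integral_count_space_nat) (auto intro!: suminf_cong arg_cong[of _ _ w] arg_cong[of _ _ ennreal])
  also have "\<dots> = ennreal (left_sum w (of_int k + z))"
    unfolding left_sum_def using assms by (intro suminf_ennreal2 summable_lattice) auto
  finally show ?thesis ..
qed

lemma left_sum_tendsto_total:
  assumes "0 < \<alpha>" and w: "\<And>x. 0 \<le> w x" "\<And>x. w x \<le> B * exp (\<alpha> * x)"
  shows "(\<lambda>n. ennreal (left_sum w (real n + z))) \<longlonglongrightarrow>
    (\<integral>\<^sup>+ j. ennreal (w (of_int j + z)) \<partial>count_space (UNIV :: int set))"
proof -
  have "(\<lambda>n. \<integral>\<^sup>+ j. ennreal (w (of_int j + z)) * indicator {..<int n} j \<partial>count_space UNIV)
    \<longlonglongrightarrow> (\<integral>\<^sup>+ j. ennreal (w (of_int j + z)) \<partial>count_space (UNIV :: int set))"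
  proof (rule nn_integral_LIMSEQ)
    show "incseq (\<lambda>n j. ennreal (w (of_int j + z)) * indicator {..<int n} j)"
      by (auto simp: incseq_def le_fun_def indicator_def)
    fix j :: int
    have "\<forall>\<^sub>F n in sequentially. ennreal (w (of_int j + z)) =
        ennreal (w (of_int j + z)) * indicator {..<int n} j"
      using eventually_gt_at_top[of "nat j"] by eventually_elim auto
    then show "(\<lambda>n. ennreal (w (of_int j + z)) * indicator {..<int n} j)
        \<longlonglongrightarrow> ennreal (w (of_int j + z))"
      by (rule Lim_transform_eventually[OF tendsto_const])
  qed auto
  then show ?thesis using left_sum_eq_nn_integral[OF assms, of "int n" z for n] by simp
qed

lemma left_sum_le_total:
  assumes "0 < \<alpha>" and w: "\<And>x. 0 \<le> w x" "\<And>x. w x \<le> B * exp (\<alpha> * x)"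
  shows "ennreal (left_sum w (of_int k + z)) \<le>
    (\<integral>\<^sup>+ j. ennreal (w (of_int j + z)) \<partial>count_space (UNIV :: int set))"
  unfolding left_sum_eq_nn_integral[OF assms]
  by (intro nn_integral_mono) (auto simp: indicator_def)

lemma left_sum_diff_eq_sum:
  assumes "0 < \<alpha>" and w: "\<And>x. 0 \<le> w x" "\<And>x. w x \<le> B * exp (\<alpha> * x)" and "a \<le> b"
  shows "left_sum w (of_int b + z) = left_sum w (of_int a + z) + (\<Sum>k\<in>{a..<b}. w (of_int k + z))"
  using \<open>a \<le> b\<close>
proof (induction b rule: int_ge_induct)
  case (step b)
  have "{a..<b + 1} = insert b {a..<b}" using step by auto
  then show ?case
    using step left_sum_step[OF assms(1-3), of "of_int b + z"] by (simp add: algebra_simps)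
qed simp

text \<open>
  If \<open>f\<close> has at most the mass of \<open>g\<close>, then \<open>\<bar>f - g\<bar> = f - g + 2 * max 0 (g - f)\<close> shows that the
  \<open>\<ell>\<^sup>1\<close> distance is at most twice the mass of \<open>max 0 (g - f)\<close>. Inside the window \<open>{a..<b}\<close> this
  positive part is controlled by the closeness of the left sums, whose increments are the
  values; outside it is at most \<open>g\<close>.
\<close>

lemma lattice_l1_distance_le:
  fixes f g :: "real \<Rightarrow> real"
  assumes \<alpha>: "0 < \<alpha>" and f: "\<And>x. 0 \<le> f x" "\<And>x. f x \<le> B * exp (\<alpha> * x)"
    and g: "\<And>x. 0 \<le> g x" "\<And>x. g x \<le> D * exp (\<alpha> * x)"
    and totf: "(\<integral>\<^sup>+ k. ennreal (f (of_int k + z)) \<partial>count_space (UNIV :: int set)) \<le> ennreal M"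
    and totg: "(\<integral>\<^sup>+ k. ennreal (g (of_int k + z)) \<partial>count_space (UNIV :: int set)) = ennreal M"
    and M: "0 \<le> M" and ab: "a \<le> b"
    and close: "\<And>k. \<bar>left_sum f (of_int k + z) - left_sum g (of_int k + z)\<bar> \<le> \<epsilon>"
  shows "(\<integral>\<^sup>+ k. ennreal \<bar>f (of_int k + z) - g (of_int k + z)\<bar> \<partial>count_space (UNIV :: int set))
    \<le> ennreal (2 * (of_int (b - a) * (2 * \<epsilon>)
        + (M - (left_sum g (of_int b + z) - left_sum g (of_int a + z)))))"
proof -
  let ?I = "\<lambda>F. \<integral>\<^sup>+ k. ennreal (F (of_int k + z)) \<partial>count_space (UNIV :: int set)"
  let ?p = "\<lambda>x. max 0 (g x - f x)"
  let ?W = "{a..<b}"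
  define S where "S = (\<Sum>k\<in>?W. g (of_int k + z))"
  have S: "S = left_sum g (of_int b + z) - left_sum g (of_int a + z)"
    using left_sum_diff_eq_sum[OF \<alpha> g ab, of z] by (simp add: S_def)
  have e0: "0 \<le> \<epsilon>" using close[of 0] by linarith
  have pw: "?p (of_int k + z) \<le> 2 * \<epsilon>" for k
  proof -
    have "left_sum f (of_int (k + 1) + z) = left_sum f (of_int k + z) + f (of_int k + z)"
      "left_sum g (of_int (k + 1) + z) = left_sum g (of_int k + z) + g (of_int k + z)"
      using left_sum_step[OF \<alpha> f, of "of_int k + z"] left_sum_step[OF \<alpha> g, of "of_int k + z"]
      by (simp_all add: algebra_simps)
    then show ?thesis using close[of k] close[of "k + 1"] by linarith
  qed
  have SM: "S \<le> M"
  proof -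
    have "ennreal S = (\<integral>\<^sup>+ k. ennreal (g (of_int k + z)) * indicator ?W k \<partial>count_space UNIV)"
      unfolding S_def using g
      by (subst nn_integral_count_space_indicator[symmetric])
        (auto simp: nn_integral_count_space_finite sum_ennreal)
    also have "\<dots> \<le> ?I g" by (intro nn_integral_mono) (auto simp: indicator_def)
    finally show ?thesis using totg M by simp
  qed
  have "?I ?p + ennreal S \<le>
      (\<integral>\<^sup>+ k. ennreal (g (of_int k + z)) + ennreal (2 * \<epsilon>) * indicator ?W k \<partial>count_space UNIV)"
  proof -
    have "?I ?p + ennreal S = (\<integral>\<^sup>+ k. ennreal (?p (of_int k + z))
        + ennreal (g (of_int k + z)) * indicator ?W k \<partial>count_space UNIV)"
      unfolding S_def using g
      by (subst nn_integral_add)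
        (auto simp: nn_integral_count_space_indicator[symmetric] nn_integral_count_space_finite sum_ennreal)
    also have "\<dots> \<le> (\<integral>\<^sup>+ k. ennreal (g (of_int k + z)) + ennreal (2 * \<epsilon>) * indicator ?W k \<partial>count_space UNIV)"
    proof (intro nn_integral_mono)
      fix k :: int
      show "ennreal (?p (of_int k + z)) + ennreal (g (of_int k + z)) * indicator ?W k
        \<le> ennreal (g (of_int k + z)) + ennreal (2 * \<epsilon>) * indicator ?W k"
        using pw[of k] f(1)[of "of_int k + z"] g(1)[of "of_int k + z"] e0
        by (cases "k \<in> ?W") (auto simp flip: ennreal_plus intro!: ennreal_leI)
    qed
    finally show ?thesis .
  qed
  also have "\<dots> = ennreal M + (\<integral>\<^sup>+ k. ennreal (2 * \<epsilon>) \<partial>count_space ?W)"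
    by (subst nn_integral_add) (auto simp: totg nn_integral_cmult_indicator)
  also have "\<dots> = ennreal M + ennreal (of_int (b - a) * (2 * \<epsilon>))"
  proof -
    have "real_of_int (b - a) = real (nat (b - a))" using ab by simp
    moreover have "ennreal (real (nat (b - a)) * (2 * \<epsilon>)) = of_nat (nat (b - a)) * ennreal (2 * \<epsilon>)"
      using e0 by (subst ennreal_mult) (simp_all only: ennreal_of_nat_eq_real_of_nat of_nat_0_le_iff)
    moreover have "(\<integral>\<^sup>+ k. ennreal (2 * \<epsilon>) \<partial>count_space ?W) = of_nat (nat (b - a)) * ennreal (2 * \<epsilon>)"
      by (simp add: mult.commute)
    ultimately show ?thesis by (simp only:)
  qed
  also have "\<dots> = ennreal (M + of_int (b - a) * (2 * \<epsilon>))"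
    using M e0 ab by simp
  finally have "?I ?p + ennreal S - ennreal S \<le> ennreal (M + of_int (b - a) * (2 * \<epsilon>)) - ennreal S"
    by (rule ennreal_minus_mono) simp
  moreover have S0: "0 \<le> S" unfolding S_def using g by (intro sum_nonneg) auto
  ultimately have P: "?I ?p \<le> ennreal (M + of_int (b - a) * (2 * \<epsilon>) - S)"
    by (simp add: ennreal_minus)
  have "?I (\<lambda>x. \<bar>f x - g x\<bar>) + ?I g = ?I f + (?I ?p + ?I ?p)"
  proof -
    have "ennreal \<bar>f x - g x\<bar> + ennreal (g x) = ennreal (f x) + (ennreal (?p x) + ennreal (?p x))" for x
      using f(1)[of x] g(1)[of x] by (cases "g x \<le> f x") (simp_all add: max_def flip: ennreal_plus)
    then show ?thesis by (simp flip: nn_integral_add)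
  qed
  also have "\<dots> \<le> ennreal M + (?I ?p + ?I ?p)" using totf by (intro add_mono) auto
  finally have "?I (\<lambda>x. \<bar>f x - g x\<bar>) \<le> ?I ?p + ?I ?p"
    unfolding totg by (subst (asm) add.commute) (auto simp: ennreal_add_left_cancel_le)
  also have "\<dots> \<le> ennreal (M + of_int (b - a) * (2 * \<epsilon>) - S) + ennreal (M + of_int (b - a) * (2 * \<epsilon>) - S)"
    using P by (intro add_mono)
  also have "\<dots> = ennreal (2 * (of_int (b - a) * (2 * \<epsilon>) + (M - S)))"
  proof -
    have "0 \<le> of_int (b - a) * (2 * \<epsilon>)" using e0 ab by simp
    then show ?thesis
      using SM by (subst ennreal_plus[symmetric]) (auto simp: algebra_simps)
  qed
  finally show ?thesis unfolding S .
qed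

section \<open>Integrals over the line as integrals of lattice sums\<close>

lemma nn_integral_lebesgue_shift:
  fixes c :: real
  assumes "f \<in> borel_measurable lebesgue"
  shows "(\<integral>\<^sup>+ x. f (x + c) \<partial>lebesgue) = (\<integral>\<^sup>+ x. f x \<partial>lebesgue)"
  using nn_integral_real_affine_lebesgue[OF assms, of 1 c] by (simp add: add.commute)

lemma measurable_lebesgue_shift:
  fixes c :: real
  assumes "f \<in> borel_measurable lebesgue"
  shows "(\<lambda>x. f (x + c)) \<in> borel_measurable lebesgue"
proof -
  have "(\<lambda>x. c + (\<Sum>j\<in>Basis. ((\<lambda>_. 1) j * (x \<bullet> j)) *\<^sub>R j)) \<in> lebesgue \<rightarrow>\<^sub>M (lebesgue :: real measure)"
    by (rule lebesgue_affine_measurable) auto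
  then have "(\<lambda>x. x + c) \<in> lebesgue \<rightarrow>\<^sub>M (lebesgue :: real measure)"
    by (simp add: add.commute)
  then show ?thesis using assms by (rule measurable_compose)
qed

lemma borel_measurable_count_space_nn_integral:
  fixes f :: "int \<Rightarrow> 'a \<Rightarrow> ennreal"
  assumes [measurable]: "\<And>k. f k \<in> borel_measurable M"
  shows "(\<lambda>x. \<integral>\<^sup>+ k. f k x \<partial>count_space UNIV) \<in> borel_measurable M"
proof -
  have "(\<integral>\<^sup>+ k. f k x \<partial>count_space UNIV) = (\<Sum>n. f (int_decode n) x)" for x
    by (subst nn_integral_bij_count_space[OF bij_int_decode, symmetric])
      (rule nn_integral_count_space_nat)
  then show ?thesis by simp
qed

text \<open>
  The half-open unit intervals partition the line, and each is translated to \<open>{0..<1}\<close>.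
\<close>

lemma nn_integral_lebesgue_periodize:
  fixes F :: "real \<Rightarrow> ennreal"
  assumes F: "F \<in> borel_measurable lebesgue"
  shows "(\<integral>\<^sup>+ x. F x \<partial>lebesgue) =
    (\<integral>\<^sup>+ \<theta> \<in> {0..<1}. (\<integral>\<^sup>+ k. F (of_int k + \<theta>) \<partial>count_space (UNIV :: int set)) \<partial>lebesgue)"
proof -
  note [measurable] = F
  have [measurable]: "(\<lambda>x. F (of_int k + x)) \<in> borel_measurable lebesgue" for k :: int
    using measurable_lebesgue_shift[OF F, of "of_int k"] by (simp add: add.commute)
  have [measurable]: "(\<lambda>x. F x * indicator {of_int k..<of_int k + 1} x) \<in> borel_measurable lebesgue" for k :: int
    by (intro borel_measurable_times_ennreal borel_measurable_indicator) simp_all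
  have [measurable]: "(\<lambda>x. F (of_int k + x) * indicator {0..<1} x) \<in> borel_measurable lebesgue" for k :: int
    by (intro borel_measurable_times_ennreal borel_measurable_indicator) simp_all
  have "F x = (\<integral>\<^sup>+ k. F x * indicator {of_int k..<of_int k + 1} x \<partial>count_space (UNIV :: int set))" for x
  proof -
    have "x \<in> {of_int k..<of_int k + 1} \<longleftrightarrow> k \<in> {\<lfloor>x\<rfloor>}" for k :: int
      by (auto simp: eq_commute[of k] floor_eq_iff)
    then have "indicator {of_int k..<of_int k + 1} x = (indicator {\<lfloor>x\<rfloor>} k :: ennreal)" for k :: int
      by (simp add: indicator_def)
    then show ?thesis by simp
  qed
  then have "(\<integral>\<^sup>+ x. F x \<partial>lebesgue) =
      (\<integral>\<^sup>+ x. (\<integral>\<^sup>+ k. F x * indicator {of_int k..<of_int k + 1} x \<partial>count_space (UNIV :: int set)) \<partial>lebesgue)"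
    by (rule nn_integral_cong)
  also have "\<dots> = (\<integral>\<^sup>+ k. (\<integral>\<^sup>+ x. F x * indicator {of_int k..<of_int k + 1} x \<partial>lebesgue) \<partial>count_space (UNIV :: int set))"
    by (rule nn_integral_count_space_nn_integral) simp_all
  also have "\<dots> = (\<integral>\<^sup>+ k. (\<integral>\<^sup>+ x. F (of_int k + x) * indicator {0..<1} x \<partial>lebesgue) \<partial>count_space (UNIV :: int set))"
  proof (rule nn_integral_cong)
    fix k :: int
    have "(\<integral>\<^sup>+ x. F x * indicator {of_int k..<of_int k + 1} x \<partial>lebesgue)
      = (\<integral>\<^sup>+ x. F (x + of_int k) * indicator {of_int k..<of_int k + 1} (x + of_int k) \<partial>lebesgue)"
      by (rule nn_integral_lebesgue_shift[symmetric]) simp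
    also have "\<dots> = (\<integral>\<^sup>+ x. F (of_int k + x) * indicator {0..<1} x \<partial>lebesgue)"
      by (intro nn_integral_cong) (auto simp: indicator_def add.commute)
    finally show "(\<integral>\<^sup>+ x. F x * indicator {of_int k..<of_int k + 1} x \<partial>lebesgue)
      = (\<integral>\<^sup>+ x. F (of_int k + x) * indicator {0..<1} x \<partial>lebesgue)" .
  qed
  also have "\<dots> = (\<integral>\<^sup>+ x. (\<integral>\<^sup>+ k. F (of_int k + x) * indicator {0..<1} x \<partial>count_space (UNIV :: int set)) \<partial>lebesgue)"
    by (rule nn_integral_count_space_nn_integral[symmetric]) simp_all
  also have "\<dots> = (\<integral>\<^sup>+ x. (\<integral>\<^sup>+ k. F (of_int k + x) \<partial>count_space (UNIV :: int set)) * indicator {0..<1} x \<partial>lebesgue)"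
    by (intro nn_integral_cong) (simp add: nn_integral_multc)
  finally show ?thesis .
qed


section \<open>The stationary wave\<close>

text \<open>
  The bound \<open>B\<close> makes the weighted profile \<open>w\<close> summable towards \<open>-\<infinity>\<close> and its left sums \<open>Q\<close> Lipschitz; the
  unit mass normalises \<open>Q\<close> to the limits \<open>0\<close> and \<open>1\<close>.
\<close>

locale stationary_wave =
  fixes \<alpha> B :: real and p :: "real \<Rightarrow> real"
  assumes \<alpha>: "0 < \<alpha>"
    and nonneg: "\<And>x. 0 \<le> p x" and le: "\<And>x. p x \<le> B"
    and deriv: "\<And>x. (p has_real_derivative (p x)\<^sup>2 - \<alpha> * p x - exp (- \<alpha>) * (p (x - 1))\<^sup>2) (at x)"
    and mass: "(\<integral>\<^sup>+ x. ennreal (exp (\<alpha> * x) * p x) \<partial>lebesgue) = 1"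
begin

definition w :: "real \<Rightarrow> real" where "w x = exp (\<alpha> * x) * p x"

abbreviation Q :: "real \<Rightarrow> real" where "Q \<equiv> left_sum w"

lemma w_nonneg: "0 \<le> w x" by (simp add: w_def nonneg)

lemma w_le: "w x \<le> B * exp (\<alpha> * x)"
  using le[of x] by (simp add: w_def mult.commute)

lemmas w_bounds = \<alpha> w_nonneg w_le

lemma w_deriv:
  "(w has_real_derivative exp (\<alpha> * x) * (p x)\<^sup>2 - exp (\<alpha> * (x - 1)) * (p (x - 1))\<^sup>2) (at x)"
proof -
  have e: "exp (\<alpha> * (x - 1)) = exp (\<alpha> * x) * exp (- \<alpha>)"
    by (simp add: algebra_simps flip: exp_add)
  have "((\<lambda>x. exp (\<alpha> * x)) has_real_derivative exp (\<alpha> * x) * \<alpha>) (at x)"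
    by (rule derivative_eq_intros refl | simp)+
  from DERIV_mult[OF this deriv[of x]] show ?thesis
    unfolding w_def e by (rule DERIV_cong) (simp only: algebra_simps)
qed

lemma B_nonneg: "0 \<le> B" using nonneg[of 0] le[of 0] by linarith

text \<open>
  By the stationary equation \<open>w' x = \<phi> x - \<phi> (x - 1)\<close> with \<open>\<phi> x = exp (\<alpha> * x) * (p x)\<^sup>2\<close>,
  so the derivative of \<open>Q\<close> telescopes.
\<close>

lemma Q_deriv: "(Q has_real_derivative exp (\<alpha> * (x - 1)) * (p (x - 1))\<^sup>2) (at x)"
proof -
  let ?p = "\<lambda>n y. - (exp (\<alpha> * (y - 1 - real n)) * (p (y - 1 - real n))\<^sup>2)"
  let ?D = "B\<^sup>2 * exp (\<alpha> * x)" and ?D' = "B * exp (\<alpha> * x)"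
  have "((\<lambda>y. \<Sum>n. w (y - 1 - real n)) has_real_derivative - ?p 0 x) (at x within {x - 1<..<x + 1})"
  proof (rule telescoping_series_derivative)
    fix n :: nat and y assume y: "y \<in> {x - 1<..<x + 1}"
    have e: "exp (\<alpha> * (y - 1 - real n)) \<le> exp (\<alpha> * x) * exp (- \<alpha>) ^ n"
      unfolding exp_geometric using y \<alpha> by (intro mult_right_mono) auto
    have "((\<lambda>y. w (y - 1 - real n)) has_real_derivative
        (exp (\<alpha> * (y - 1 - real n)) * (p (y - 1 - real n))\<^sup>2
          - exp (\<alpha> * (y - 1 - real n - 1)) * (p (y - 1 - real n - 1))\<^sup>2) * 1)
        (at y within {x - 1<..<x + 1})"
      by (rule DERIV_chain2[where f = w, OF w_deriv]) (rule derivative_eq_intros refl | simp)+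
    then show "((\<lambda>y. w (y - 1 - real n)) has_real_derivative ?p (Suc n) y - ?p n y) (at y within {x - 1<..<x + 1})"
      by (simp add: algebra_simps)
    have "(p (y - 1 - real n))\<^sup>2 * exp (\<alpha> * (y - 1 - real n)) \<le> B\<^sup>2 * (exp (\<alpha> * x) * exp (- \<alpha>) ^ n)"
      using e le nonneg by (intro mult_mono power_mono) auto
    then show "\<bar>?p n y\<bar> \<le> ?D * exp (- \<alpha>) ^ n" by (simp add: mult_ac)
    have "p (y - 1 - real n) * exp (\<alpha> * (y - 1 - real n)) \<le> B * (exp (\<alpha> * x) * exp (- \<alpha>) ^ n)"
      using e le nonneg B_nonneg by (intro mult_mono) auto
    then show "\<bar>w (y - 1 - real n)\<bar> \<le> ?D' * exp (- \<alpha>) ^ n"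
      using nonneg by (simp add: mult_ac w_def abs_mult)
  qed (use \<alpha> in auto)
  moreover have "at x within {x - 1<..<x + 1} = at x" by (rule at_within_open) auto
  moreover have "Q = (\<lambda>y. \<Sum>n. w (y - 1 - real n))" by (simp add: fun_eq_iff left_sum_def)
  ultimately show ?thesis by simp
qed

lemma Q_mono: "x \<le> y \<Longrightarrow> Q x \<le> Q y"
proof (rule DERIV_nonneg_imp_nondecreasing[where f = Q])
  fix z
  have "0 \<le> exp (\<alpha> * (z - 1)) * (p (z - 1))\<^sup>2" by simp
  then show "\<exists>y. (Q has_real_derivative y) (at z) \<and> 0 \<le> y" using Q_deriv[of z] by metis
qed

lemma Q_nonneg: "0 \<le> Q x" by (rule left_sum_nonneg[OF w_bounds])

lemma Q_step: "Q (x + 1) = Q x + w x" by (rule left_sum_step[OF w_bounds])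

lemma continuous_p: "continuous_on S p"
  by (rule DERIV_continuous_on, rule has_field_derivative_at_within, rule deriv)

lemma measurable_p [measurable]: "p \<in> borel_measurable borel"
  by (rule borel_measurable_continuous_onI) (rule continuous_p)

text \<open>
  The mass of \<open>w\<close> on \<open>\<int> + z\<close> is the limit of \<open>Q (n + z)\<close>. As \<open>Q\<close> is nondecreasing, it is nondecreasing in
  \<open>z\<close>; as it has period one in \<open>z\<close>, it is constant. Its mean over a period is the
  integral of \<open>w\<close>, which is one.
\<close>

lemma lattice_mass: "(\<integral>\<^sup>+ k. ennreal (w (of_int k + z)) \<partial>count_space (UNIV :: int set)) = 1"
proof -
  let ?M = "\<lambda>z. \<integral>\<^sup>+ k. ennreal (w (of_int k + z)) \<partial>count_space (UNIV :: int set)"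
  have lim: "(\<lambda>n. ennreal (Q (real n + z))) \<longlonglongrightarrow> ?M z" for z
    by (rule left_sum_tendsto_total[OF w_bounds])
  have mono: "?M y \<le> ?M z" if "y \<le> z" for y z
    by (rule LIMSEQ_le[OF lim lim]) (auto intro!: exI[of _ 0] ennreal_leI Q_mono that)
  have shift: "?M (z + of_int j) = ?M z" for z j
    using nn_integral_int_shift[of "\<lambda>k. ennreal (w (of_int k + z))" j] by (simp add: algebra_simps)
  have const: "?M y = ?M z" for y z
  proof -
    have "?M y \<le> ?M z" for y z
    proof -
      \<comment> \<open>an integer translate of \<open>z\<close> to the right of \<open>y\<close>\<close>
      have "?M y \<le> ?M (z + of_int \<lceil>y - z\<rceil>)" by (intro mono) linarith
      then show ?thesis unfolding shift .
    qed
    then show ?thesis by (intro antisym)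
  qed
  have "w \<in> borel_measurable lebesgue"
    unfolding w_def[abs_def] by (intro measurable_completion) measurable
  then have "(\<integral>\<^sup>+ x. ennreal (w x) \<partial>lebesgue) = (\<integral>\<^sup>+ \<theta> \<in> {0..<1}. ?M \<theta> \<partial>lebesgue)"
    by (intro nn_integral_lebesgue_periodize) auto
  also have "\<dots> = (\<integral>\<^sup>+ \<theta>. ?M z * indicator {0..<1::real} \<theta> \<partial>lebesgue)"
    using const by (intro nn_integral_cong) (metis (no_types, lifting))
  also have "\<dots> = ?M z" by (simp add: nn_integral_cmult_indicator)
  finally show ?thesis using mass by (simp add: w_def)
qed

lemma Q_le_1: "Q x \<le> 1"
  using left_sum_le_total[OF w_bounds, of 0 x] by (simp add: lattice_mass)

lemma w_le_1: "w x \<le> 1"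
  using Q_le_1[of "x + 1"] Q_nonneg[of x] by (simp add: Q_step)

text \<open>
  The derivative of \<open>Q\<close> is \<open>w (z - 1) * p (z - 1)\<close>; the first factor is at most one because \<open>w\<close> is an
  increment of \<open>Q\<close>, which takes values in \<open>{0..1}\<close>.
\<close>

lemma Q_lipschitz: "\<bar>Q x - Q y\<bar> \<le> B * \<bar>x - y\<bar>"
proof -
  have "norm (Q x - Q y) \<le> B * norm (x - y)"
  proof (rule field_differentiable_bound[of UNIV])
    fix z
    show "(Q has_real_derivative w (z - 1) * p (z - 1)) (at z within UNIV)"
      using Q_deriv[of z] by (simp add: w_def power2_eq_square mult.assoc)
    have "w (z - 1) * p (z - 1) \<le> 1 * B"
      by (rule mult_mono) (auto simp: w_le_1 le nonneg)
    then show "norm (w (z - 1) * p (z - 1)) \<le> B"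
      by (simp add: w_nonneg nonneg)
  qed auto
  then show ?thesis by simp
qed

lemma Q_at_bot: "(Q \<longlongrightarrow> 0) at_bot"
proof (rule tendsto_sandwich[OF _ _ tendsto_const])
  have "filterlim (\<lambda>x. \<alpha> * x) at_bot at_bot"
    using \<alpha> by (rule filterlim_tendsto_pos_mult_at_bot[OF tendsto_const _ filterlim_ident])
  then have "((\<lambda>x. exp (\<alpha> * x)) \<longlongrightarrow> 0) at_bot"
    by (rule filterlim_compose[OF exp_at_bot])
  then show "((\<lambda>x. B / (exp \<alpha> - 1) * exp (\<alpha> * x)) \<longlongrightarrow> 0) at_bot"
    by (rule tendsto_mult_right_zero)
  show "\<forall>\<^sub>F x in at_bot. Q x \<le> B / (exp \<alpha> - 1) * exp (\<alpha> * x)"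
    using left_sum_le[OF w_bounds] by simp
qed (auto simp: Q_nonneg)

lemma Q_at_top: "(Q \<longlongrightarrow> 1) at_top"
proof (rule tendsto_sandwich[OF _ _ _ tendsto_const])
  have *: "(\<lambda>n. Q (real n)) \<longlonglongrightarrow> 1"
    using left_sum_tendsto_total[OF w_bounds, of 0] lattice_mass[of 0] Q_nonneg
    tendsto_ennreal_iff[of "\<lambda>n. Q (real n)" sequentially 1] by auto
  show "((\<lambda>x. Q (real (nat \<lfloor>x\<rfloor>))) \<longlongrightarrow> 1) at_top"
    by (rule filterlim_compose[OF *])
      (intro filterlim_compose[OF filterlim_nat_sequentially] filterlim_floor_sequentially)
  show "\<forall>\<^sub>F x in at_top. Q (real (nat \<lfloor>x\<rfloor>)) \<le> Q x"
    using eventually_ge_at_top[of 0] by eventually_elim (auto intro!: Q_mono)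
qed (auto simp: Q_le_1)

end

section \<open>The solution along characteristics\<close>

text \<open>
  \<open>W t\<close> is the weighted solution, and \<open>U y t\<close> its left sum at the point \<open>y - t\<close> of the
  characteristic that starts in \<open>y\<close>.
\<close>

locale evolution =
  fixes \<alpha> :: real and h0 :: "real \<Rightarrow> real" and h :: "real \<Rightarrow> real \<Rightarrow> real"
  assumes \<alpha>_pos: "0 < \<alpha>" and sol: "evol_solution \<alpha> h0 h"
begin

definition W :: "real \<Rightarrow> real \<Rightarrow> real" where "W t x = exp (\<alpha> * x) * h t x"

definition U :: "real \<Rightarrow> real \<Rightarrow> real" where "U y t = left_sum (W t) (y - t)"

lemma h_nonneg: "0 \<le> t \<Longrightarrow> 0 \<le> h t x"
  using sol by (simp add: evol_solution_def)

lemma h_init: "h 0 x = h0 x"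
  using sol by (simp add: evol_solution_def)

lemma h_deriv:
  "0 \<le> t \<Longrightarrow> ((\<lambda>s. h s (y - s)) has_real_derivative evol_rhs \<alpha> h y t) (at t within {0..})"
  using sol by (simp add: evol_solution_def)

lemma h_bound:
  obtains B where "0 < B" "\<And>t x. t \<in> {0..T} \<Longrightarrow> h t x \<le> B"
proof -
  have "bounded {h t x |t x. 0 \<le> t \<and> t \<le> max 1 T}"
    using sol unfolding evol_solution_def by auto
  then obtain B where B: "0 < B" "\<And>y. y \<in> {h t x |t x. 0 \<le> t \<and> t \<le> max 1 T} \<Longrightarrow> norm y \<le> B"
    unfolding bounded_pos by blast
  show thesis
  proof (rule that[OF B(1)])
    fix t x assume "t \<in> {0..T}"
    then show "h t x \<le> B" using B(2)[of "h t x"] by force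
  qed
qed

lemma W_nonneg: "0 \<le> t \<Longrightarrow> 0 \<le> W t x"
  by (simp add: W_def h_nonneg)

lemma W_bound:
  obtains B where "0 < B" "\<And>t x. t \<in> {0..T} \<Longrightarrow> W t x \<le> B * exp (\<alpha> * x)"
proof -
  obtain B where "0 < B" "\<And>t x. t \<in> {0..T} \<Longrightarrow> h t x \<le> B" using h_bound by blast
  then show thesis by (intro that[of B]) (auto simp: W_def mult.commute)
qed

lemma U_nonneg: assumes "0 \<le> t" shows "0 \<le> U y t"
proof -
  obtain B where "\<And>s x. s \<in> {0..t} \<Longrightarrow> W s x \<le> B * exp (\<alpha> * x)" using W_bound by blast
  then show ?thesis
    using left_sum_nonneg[OF \<alpha>_pos W_nonneg[OF assms], where B = B] assms by (simp add: U_def)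
qed

lemma U_step: assumes "0 \<le> t" shows "U (y + 1) t = U y t + W t (y - t)"
proof -
  obtain B where "\<And>s x. s \<in> {0..t} \<Longrightarrow> W s x \<le> B * exp (\<alpha> * x)" using W_bound by blast
  then show ?thesis
    using left_sum_step[OF \<alpha>_pos W_nonneg[OF assms], where B = B and z = "y - t"] assms
    by (simp add: U_def algebra_simps)
qed

lemma U_le:
  obtains B where "0 < B" "\<And>t y. t \<in> {0..T} \<Longrightarrow> U y t \<le> B * exp (\<alpha> * y)"
proof -
  obtain B where B: "0 < B" "\<And>t x. t \<in> {0..T} \<Longrightarrow> W t x \<le> B * exp (\<alpha> * x)" using W_bound by blast
  show thesis
  proof (rule that)
    show pos: "0 < B / (exp \<alpha> - 1)" using B \<alpha>_pos by simp
    fix t y assume t: "t \<in> {0..T}"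
    have "U y t \<le> B / (exp \<alpha> - 1) * exp (\<alpha> * (y - t))"
      unfolding U_def using t B by (intro left_sum_le[OF \<alpha>_pos W_nonneg]) auto
    also have "\<dots> \<le> B / (exp \<alpha> - 1) * exp (\<alpha> * y)"
      using t pos \<alpha>_pos by (intro mult_left_mono) auto
    finally show "U y t \<le> B / (exp \<alpha> - 1) * exp (\<alpha> * y)" .
  qed
qed

text \<open>
  Along a characteristic the weight absorbs the linear term \<open>\<alpha> * h\<close>, and the quadratic terms become
  a difference of fluxes at neighbouring lattice points; the series of derivatives telescopes.
\<close>

lemma U_deriv:
  assumes t: "0 \<le> t"
  shows "(U y has_real_derivative - (exp (\<alpha> * (y - 1 - t)) * (h t (y - 1 - t))\<^sup>2)) (at t within {0..})"
proof -
  let ?S = "{0..t + 1}"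
  let ?p = "\<lambda>n s. exp (\<alpha> * (y - 1 - real n - s)) * (h s (y - 1 - real n - s))\<^sup>2"
  obtain B where B: "0 < B" "\<And>s x. s \<in> ?S \<Longrightarrow> h s x \<le> B" using h_bound by blast
  let ?D = "B\<^sup>2 * exp (\<alpha> * (y - 1))" and ?D' = "B * exp (\<alpha> * (y - 1))"
  have "((\<lambda>s. \<Sum>n. W s (y - s - 1 - real n)) has_real_derivative - ?p 0 t) (at t within ?S)"
  proof (rule telescoping_series_derivative)
    fix n :: nat and s assume s: "s \<in> ?S"
    define y' where "y' = y - 1 - real n"
    have W: "W s (y - s - 1 - real n) = exp (\<alpha> * (y' - s)) * h s (y' - s)" for s
    proof -
      have "y - s - 1 - real n = y' - s" by (simp add: y'_def)
      then show ?thesis by (simp only: W_def)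
    qed
    have e: "exp (\<alpha> * (y' - s)) \<le> exp (\<alpha> * (y - 1)) * exp (- \<alpha>) ^ n"
      unfolding y'_def exp_geometric[symmetric] using s \<alpha>_pos by auto
    have "((\<lambda>s. exp (\<alpha> * (y' - s))) has_real_derivative exp (\<alpha> * (y' - s)) * - \<alpha>) (at s within ?S)"
      by (rule derivative_eq_intros refl | simp)+
    moreover have "((\<lambda>s. h s (y' - s)) has_real_derivative evol_rhs \<alpha> h y' s) (at s within ?S)"
      by (rule DERIV_subset[OF h_deriv]) (use s in auto)
    ultimately have "((\<lambda>s. exp (\<alpha> * (y' - s)) * h s (y' - s)) has_real_derivative
        exp (\<alpha> * (y' - s)) * - \<alpha> * h s (y' - s) + evol_rhs \<alpha> h y' s * exp (\<alpha> * (y' - s))) (at s within ?S)"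
      by (rule DERIV_mult)
    moreover have "exp (\<alpha> * (y' - s)) * - \<alpha> * h s (y' - s) + evol_rhs \<alpha> h y' s * exp (\<alpha> * (y' - s))
      = ?p (Suc n) s - ?p n s"
    proof -
      have "?p (Suc n) s = exp (\<alpha> * (y' - s)) * exp (- \<alpha>) * (h s (y' - s - 1))\<^sup>2"
        by (simp add: y'_def algebra_simps flip: exp_add)
      moreover have "?p n s = exp (\<alpha> * (y' - s)) * (h s (y' - s))\<^sup>2" by (simp add: y'_def)
      ultimately show ?thesis by (simp only: evol_rhs_def) (simp only: algebra_simps)
    qed
    ultimately show "((\<lambda>s. W s (y - s - 1 - real n)) has_real_derivative ?p (Suc n) s - ?p n s) (at s within ?S)"
      by (simp only: W)
    have h: "0 \<le> h s (y' - s)" by (rule h_nonneg) (use s in auto)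
    have "(h s (y' - s))\<^sup>2 * exp (\<alpha> * (y' - s)) \<le> B\<^sup>2 * (exp (\<alpha> * (y - 1)) * exp (- \<alpha>) ^ n)"
      using e B(2)[OF s] h by (intro mult_mono power_mono) auto
    moreover have "?p n s = (h s (y' - s))\<^sup>2 * exp (\<alpha> * (y' - s))" by (simp add: y'_def)
    ultimately show "\<bar>?p n s\<bar> \<le> ?D * exp (- \<alpha>) ^ n" by (simp add: mult.assoc)
    have "h s (y' - s) * exp (\<alpha> * (y' - s)) \<le> B * (exp (\<alpha> * (y - 1)) * exp (- \<alpha>) ^ n)"
      using e B(2)[OF s] B(1) h by (intro mult_mono) auto
    moreover have "W s (y - s - 1 - real n) = h s (y' - s) * exp (\<alpha> * (y' - s))"
      by (simp only: W mult.commute)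
    moreover have "0 \<le> W s (y - s - 1 - real n)" by (rule W_nonneg) (use s in auto)
    ultimately show "\<bar>W s (y - s - 1 - real n)\<bar> \<le> ?D' * exp (- \<alpha>) ^ n"
      by (simp add: mult.assoc)
  qed (use \<alpha>_pos t in auto)
  moreover have "(\<lambda>s. \<Sum>n. W s (y - s - 1 - real n)) = U y" by (simp add: U_def left_sum_def fun_eq_iff)
  moreover have "at t within ?S = at t within {0..}"
    by (rule at_within_nhd[of _ "{..<t + 1}"]) auto
  ultimately show ?thesis by simp
qed

text \<open>
  The flux in terms of the increment \<open>U y t - U (y - 1) t\<close>. The coefficient depends on time only through the
  factor \<open>exp (\<alpha> * t)\<close>, so the system is autonomous in the time variable \<open>exp (\<alpha> * t)\<close>.
\<close>

lemma U_deriv_upwind: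
  assumes t: "0 \<le> t"
  shows "(U y has_real_derivative
    - (exp (\<alpha> * t) * exp (- \<alpha> * (y - 1))) * (U y t - U (y - 1) t)\<^sup>2) (at t within {0..})"
proof -
  let ?x = "y - 1 - t"
  have regroup: "c * (E * H)\<^sup>2 = (c * E) * (E * H\<^sup>2)" for c E H :: real
    by (simp add: power2_eq_square mult_ac)
  have "U y t - U (y - 1) t = exp (\<alpha> * ?x) * h t ?x"
    using U_step[OF t, of "y - 1"] by (simp add: W_def)
  moreover have "exp (\<alpha> * t) * exp (- \<alpha> * (y - 1)) * exp (\<alpha> * ?x) = 1"
    by (simp add: algebra_simps flip: exp_add)
  ultimately have "exp (\<alpha> * t) * exp (- \<alpha> * (y - 1)) * (U y t - U (y - 1) t)\<^sup>2 = exp (\<alpha> * ?x) * (h t ?x)\<^sup>2"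
    using regroup[of "exp (\<alpha> * t) * exp (- \<alpha> * (y - 1))" "exp (\<alpha> * ?x)" "h t ?x"] by (simp only: mult_1)
  then show ?thesis using U_deriv[OF t, of y] by simp
qed

lemma U_antimono: assumes "0 \<le> t" shows "U y t \<le> U y 0"
proof (cases "t = 0")
  case False
  let ?d = "\<lambda>t. - (exp (\<alpha> * (y - 1 - t)) * (h t (y - 1 - t))\<^sup>2)"
  have "\<exists>r\<in>{0<..<t}. U y t - U y 0 = (*) (?d r) (t - 0)"
  proof (rule mvt_simple)
    fix r assume "0 \<le> r" "r \<le> t"
    then show "(U y has_derivative (*) (?d r)) (at r within {0..t})"
      unfolding has_field_derivative_def[symmetric] by (intro DERIV_subset[OF U_deriv]) auto
  qed (use assms False in auto)
  then obtain r where "U y t - U y 0 = ?d r * t" by auto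
  moreover have "0 \<le> exp (\<alpha> * (y - 1 - r)) * (h r (y - 1 - r))\<^sup>2 * t" using assms by simp
  ultimately show ?thesis by simp
qed simp

lemma U_tendsto_mass: assumes "0 \<le> t"
  shows "(\<lambda>n. ennreal (U (real n + \<theta>) t)) \<longlonglongrightarrow>
    (\<integral>\<^sup>+ k. ennreal (W t (of_int k + (\<theta> - t))) \<partial>count_space (UNIV :: int set))"
proof -
  obtain B where B: "\<And>s x. s \<in> {0..t} \<Longrightarrow> W s x \<le> B * exp (\<alpha> * x)" using W_bound by blast
  have "(\<lambda>n. ennreal (left_sum (W t) (real n + (\<theta> - t)))) \<longlonglongrightarrow>
    (\<integral>\<^sup>+ k. ennreal (W t (of_int k + (\<theta> - t))) \<partial>count_space (UNIV :: int set))"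
    by (rule left_sum_tendsto_total[OF \<alpha>_pos W_nonneg B]) (use assms in auto)
  then show ?thesis by (simp add: U_def algebra_simps)
qed

lemma m0_eq: "m0 \<alpha> h0 \<theta> = (\<integral>\<^sup>+ k. ennreal (W 0 (of_int k + \<theta>)) \<partial>count_space UNIV)"
  by (simp add: m0_def W_def h_init)

lemma U_le_mass:
  assumes "0 \<le> t" shows "ennreal (U (of_int k + \<theta>) t) \<le> m0 \<alpha> h0 \<theta>"
proof -
  obtain B where B: "\<And>s x. s \<in> {0..0} \<Longrightarrow> W s x \<le> B * exp (\<alpha> * x)" using W_bound by blast
  have "ennreal (U (of_int k + \<theta>) t) \<le> ennreal (U (of_int k + \<theta>) 0)"
    using U_antimono[OF assms] by (rule ennreal_leI)
  also have "\<dots> \<le> m0 \<alpha> h0 \<theta>"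
    unfolding m0_eq U_def diff_zero
    by (rule left_sum_le_total[OF \<alpha>_pos W_nonneg B]) auto
  finally show ?thesis .
qed

text \<open>
  Left sums do not increase in time, so neither does their supremum, the mass of the lattice.
\<close>

lemma mass_le:
  assumes "0 \<le> t"
  shows "(\<integral>\<^sup>+ k. ennreal (W t (of_int k + (\<theta> - t))) \<partial>count_space (UNIV :: int set)) \<le> m0 \<alpha> h0 \<theta>"
proof (rule LIMSEQ_le_const2[OF U_tendsto_mass[OF assms]])
  have "ennreal (U (real n + \<theta>) t) \<le> m0 \<alpha> h0 \<theta>" for n
    using U_le_mass[OF assms, of "int n" \<theta>] by simp
  then show "\<exists>N. \<forall>n\<ge>N. ennreal (U (real n + \<theta>) t) \<le> m0 \<alpha> h0 \<theta>" by blast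
qed

end

section \<open>Convergence on one lattice\<close>

text \<open>
  One lattice \<open>\<int> + \<theta>\<close> of finite positive mass \<open>M\<close>. Translating the wave by \<open>\<mu>0\<close> multiplies its
  mass by \<open>exp (\<alpha> * \<mu>0)\<close>, which fixes \<open>\<mu>0\<close>. The quantity \<open>V s k\<close> is the left sum of the translated wave
  at the lattice point \<open>k + \<theta> - s\<close>.
\<close>

locale relaxation = evolution \<alpha> h0 h + stationary_wave \<alpha> B p
  for \<alpha> h0 h B p +
  fixes \<theta> M \<mu>0 :: real
  assumes mass_M: "m0 \<alpha> h0 \<theta> = ennreal M" and M_eq: "M = exp (\<alpha> * \<mu>0)"
begin

lemma M_pos: "0 < M" by (simp add: M_eq)

definition V :: "real \<Rightarrow> int \<Rightarrow> real" where "V s k = M * Q (of_int k + \<theta> - s - \<mu>0)"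

text \<open>
  The time \<open>s\<close> with \<open>exp (\<alpha> * s) = exp (\<alpha> * t) + const\<close> and \<open>s = s0\<close> at \<open>t = 0\<close>: a translation in the
  variable in which the system is autonomous.
\<close>

definition clock :: "real \<Rightarrow> real \<Rightarrow> real" where
  "clock s0 t = ln (exp (\<alpha> * t) + (exp (\<alpha> * s0) - 1)) / \<alpha>"

lemma clock_arg_ge: "0 \<le> t \<Longrightarrow> exp (\<alpha> * s0) \<le> exp (\<alpha> * t) + (exp (\<alpha> * s0) - 1)"
  using \<alpha> by simp

lemma exp_clock: "0 \<le> t \<Longrightarrow> exp (\<alpha> * clock s0 t) = exp (\<alpha> * t) + (exp (\<alpha> * s0) - 1)"
  using \<alpha> less_le_trans[OF exp_gt_zero clock_arg_ge] by (simp add: clock_def)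

lemma clock_ge: assumes "0 \<le> t" shows "s0 \<le> clock s0 t"
proof -
  have "exp (\<alpha> * s0) \<le> exp (\<alpha> * clock s0 t)" using clock_arg_ge exp_clock assms by simp
  then show ?thesis using \<alpha> by simp
qed

lemma clock_0: "clock s0 0 = s0"
  using \<alpha> by (simp add: clock_def)

lemma clock_deriv:
  assumes "0 \<le> t"
  shows "(clock s0 has_real_derivative exp (\<alpha> * t) / exp (\<alpha> * clock s0 t)) (at t)"
proof -
  have "0 < exp (\<alpha> * t) + (exp (\<alpha> * s0) - 1)"
    using less_le_trans[OF exp_gt_zero clock_arg_ge[OF assms]] .
  note pos = this
  have "((\<lambda>t. exp (\<alpha> * t) + (exp (\<alpha> * s0) - 1)) has_real_derivative exp (\<alpha> * t) * \<alpha>) (at t)"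
    by (rule derivative_eq_intros refl | simp)+
  from DERIV_cdivide[OF DERIV_chain2[OF DERIV_ln[OF pos] this], of \<alpha>]
  show ?thesis
    unfolding exp_clock[OF assms] unfolding clock_def[abs_def]
    by (rule DERIV_cong) (use \<alpha> in \<open>simp add: divide_inverse\<close>)
qed

text \<open>
  Translating \<open>exp (\<alpha> * t)\<close> by a constant changes \<open>t\<close> less and less:
  \<open>clock s0 t - t = ln (1 + (exp (\<alpha> * s0) - 1) * exp (- \<alpha> * t)) / \<alpha>\<close>.
\<close>

lemma clock_asymp: "((\<lambda>t. clock s0 t - t) \<longlongrightarrow> 0) at_top"
proof -
  let ?c = "exp (\<alpha> * s0) - 1"
  have "filterlim (\<lambda>t. - \<alpha> * t) at_bot at_top"
    using \<alpha> by (intro filterlim_tendsto_neg_mult_at_bot[OF tendsto_const _ filterlim_ident]) auto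
  then have "((\<lambda>t. exp (- \<alpha> * t)) \<longlongrightarrow> 0) at_top"
    by (rule filterlim_compose[OF exp_at_bot])
  then have "((\<lambda>t. ln (1 + ?c * exp (- \<alpha> * t)) / \<alpha>) \<longlongrightarrow> ln (1 + ?c * 0) / \<alpha>) at_top"
    using \<alpha> by (intro tendsto_intros) auto
  then have "((\<lambda>t. ln (1 + ?c * exp (- \<alpha> * t)) / \<alpha>) \<longlongrightarrow> 0) at_top" by simp
  moreover have "\<forall>\<^sub>F t in at_top. ln (1 + ?c * exp (- \<alpha> * t)) / \<alpha> = clock s0 t - t"
    using eventually_ge_at_top[of 0]
  proof eventually_elim
    case (elim t)
    have e: "1 + ?c * exp (- \<alpha> * t) = exp (\<alpha> * clock s0 t) / exp (\<alpha> * t)"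
      unfolding exp_clock[OF elim] by (simp add: field_simps exp_minus)
    have "ln (1 + ?c * exp (- \<alpha> * t)) = \<alpha> * clock s0 t - \<alpha> * t"
      unfolding e by (simp flip: exp_diff)
    then show ?case using \<alpha> by (simp add: field_simps)
  qed
  ultimately show ?thesis by (rule Lim_transform_eventually)
qed

lemma V_nonneg: "0 \<le> V s k" using M_pos Q_nonneg by (simp add: V_def)

lemma V_le: "V s k \<le> M" using M_pos Q_le_1 by (simp add: V_def)

lemma V_mono: assumes "k \<le> l" "s' \<le> s" shows "V s k \<le> V s' l"
proof -
  have "real_of_int k \<le> real_of_int l" using assms by simp
  then show ?thesis unfolding V_def using M_pos assms by (intro mult_left_mono Q_mono) auto
qed

text \<open>
  The chain rule produces the factor \<open>exp (\<alpha> * t) / exp (\<alpha> * s)\<close>, which turns the coefficient of the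
  upwind equation at time \<open>s\<close> into the coefficient at time \<open>t\<close>: the wave read off at \<open>clock s0 t\<close> solves the same
  system as \<open>U\<close>.
\<close>

lemma V_deriv:
  assumes t: "0 \<le> t"
  shows "((\<lambda>t. V (clock s0 t) k) has_real_derivative
    - (exp (\<alpha> * t) * exp (- \<alpha> * (of_int k + \<theta> - 1)))
      * (V (clock s0 t) k - V (clock s0 t) (k - 1))\<^sup>2) (at t within {0..})"
proof -
  define s where "s = clock s0 t"
  define x where "x = of_int k + \<theta> - s - \<mu>0"
  define E where "E = exp (\<alpha> * (x - 1))"
  define H where "H = p (x - 1)"
  have "((\<lambda>t. of_int k + \<theta> - clock s0 t - \<mu>0) has_real_derivative - (exp (\<alpha> * t) / exp (\<alpha> * s))) (at t)"
    using clock_deriv[OF t] unfolding s_def by (auto intro!: derivative_eq_intros)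
  moreover have "(Q has_real_derivative E * H\<^sup>2) (at (of_int k + \<theta> - clock s0 t - \<mu>0))"
    using Q_deriv[of x] by (simp add: E_def H_def x_def s_def)
  ultimately have "((\<lambda>t. Q (of_int k + \<theta> - clock s0 t - \<mu>0)) has_real_derivative
      E * H\<^sup>2 * - (exp (\<alpha> * t) / exp (\<alpha> * s))) (at t)"
    by (rule DERIV_chain2[rotated])
  then have "((\<lambda>t. V (clock s0 t) k) has_real_derivative
      M * (E * H\<^sup>2 * - (exp (\<alpha> * t) / exp (\<alpha> * s)))) (at t)"
    unfolding V_def by (rule DERIV_cmult)
  moreover have "M * (E * H\<^sup>2 * - (exp (\<alpha> * t) / exp (\<alpha> * s))) =
     - (exp (\<alpha> * t) * exp (- \<alpha> * (of_int k + \<theta> - 1))) * (V s k - V s (k - 1))\<^sup>2"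
  proof -
    have "Q x = Q (x - 1) + w (x - 1)" using Q_step[of "x - 1"] by simp
    moreover have "V s k = M * Q x" "V s (k - 1) = M * Q (x - 1)"
      by (simp_all add: V_def x_def algebra_simps)
    ultimately have 1: "V s k - V s (k - 1) = M * (E * H)"
      by (simp add: w_def E_def H_def algebra_simps)
    have 2: "exp (- \<alpha> * (of_int k + \<theta> - 1)) * (M * E) = 1 / exp (\<alpha> * s)"
      unfolding M_eq E_def x_def by (simp add: algebra_simps flip: exp_add exp_minus' exp_diff)
    have 3: "- (a * b) * (M * (E * H))\<^sup>2 = - a * (b * (M * E)) * (M * (E * H\<^sup>2))" for a b :: real
      by (simp add: power2_eq_square mult_ac)
    show ?thesis unfolding 1 3 2 by simp
  qed
  ultimately show ?thesis unfolding s_def by (metis has_field_derivative_at_within)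
qed

lemma U_le_M: assumes "0 \<le> t" shows "U (of_int k + \<theta>) t \<le> M"
  using U_le_mass[OF assms, of k \<theta>] M_pos unfolding mass_M by simp

lemma U_left_small:
  assumes "0 < \<epsilon>" shows "\<exists>K. \<forall>k\<le>K. \<forall>t\<in>{0..T}. U (of_int k + \<theta>) t \<le> \<epsilon>"
proof -
  obtain D where D: "0 < D" "\<And>t y. t \<in> {0..T} \<Longrightarrow> U y t \<le> D * exp (\<alpha> * y)" using U_le by blast
  \<comment> \<open>chosen so that \<open>D * exp (\<alpha> * (K + \<theta>)) \<le> \<epsilon>\<close>\<close>
  define K where "K = \<lfloor>ln (\<epsilon> / D) / \<alpha> - \<theta>\<rfloor>"
  have "U (of_int k + \<theta>) t \<le> \<epsilon>" if "k \<le> K" "t \<in> {0..T}" for k t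
  proof -
    have "of_int k + \<theta> \<le> ln (\<epsilon> / D) / \<alpha>" using that(1) unfolding K_def by linarith
    then have "\<alpha> * (of_int k + \<theta>) \<le> ln (\<epsilon> / D)" using \<alpha> by (simp add: field_simps)
    then have "exp (\<alpha> * (of_int k + \<theta>)) \<le> exp (ln (\<epsilon> / D))" by simp
    then have "D * exp (\<alpha> * (of_int k + \<theta>)) \<le> \<epsilon>" using D assms by (simp add: field_simps)
    then show ?thesis using D(2)[OF that(2), of "of_int k + \<theta>"] by linarith
  qed
  then show ?thesis by blast
qed

lemma U_mono: "0 \<le> t \<Longrightarrow> U (y - 1) t \<le> U y t"
  using U_step[of t "y - 1"] W_nonneg[of t] by simp

lemma U_mono_int: assumes "0 \<le> t" "k \<le> l" shows "U (of_int k + \<theta>) t \<le> U (of_int l + \<theta>) t"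
  using assms(2)
proof (induction l rule: int_ge_induct)
  case (step l)
  then show ?case using U_mono[OF assms(1), of "of_int (l + 1) + \<theta>"] by (simp add: algebra_simps)
qed simp

lemma U_right_large:
  assumes "0 < \<epsilon>" shows "\<exists>N. \<forall>k\<ge>N. M - \<epsilon> \<le> U (of_int k + \<theta>) 0"
proof -
  have "(\<lambda>n. ennreal (U (real n + \<theta>) 0)) \<longlonglongrightarrow> ennreal M"
    using U_tendsto_mass[of 0 \<theta>] mass_M by (simp add: m0_eq)
  then have "(\<lambda>n. U (real n + \<theta>) 0) \<longlonglongrightarrow> M"
    using M_pos U_nonneg by simp
  then have "\<forall>\<^sub>F n in sequentially. M - \<epsilon> < U (real n + \<theta>) 0"
    using assms by (intro order_tendstoD) auto
  then obtain n where "M - \<epsilon> < U (real n + \<theta>) 0" by (auto simp: eventually_sequentially)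
  then have "M - \<epsilon> \<le> U (of_int k + \<theta>) 0" if "int n \<le> k" for k
    using U_mono_int[OF order_refl that] by simp
  then show ?thesis by blast
qed

lemma V_small: assumes "0 < \<epsilon>" shows "\<exists>R. \<forall>s k. of_int k - s \<le> R \<longrightarrow> V s k \<le> \<epsilon>"
proof -
  have "\<forall>\<^sub>F z in at_bot. Q z < \<epsilon> / M" using assms M_pos by (intro order_tendstoD[OF Q_at_bot]) auto
  then obtain z0 where z0: "\<And>z. z \<le> z0 \<Longrightarrow> Q z < \<epsilon> / M" by (auto simp: eventually_at_bot_linorder)
  have "V s k \<le> \<epsilon>" if "of_int k - s \<le> z0 - \<theta> + \<mu>0" for s k
    using z0[of "of_int k + \<theta> - s - \<mu>0"] that M_pos by (simp add: V_def field_simps)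
  then show ?thesis by blast
qed

lemma V_large: assumes "0 < \<epsilon>" shows "\<exists>R. \<forall>s k. R \<le> of_int k - s \<longrightarrow> M - \<epsilon> \<le> V s k"
proof -
  have "\<forall>\<^sub>F z in at_top. 1 - \<epsilon> / M < Q z" using assms M_pos by (intro order_tendstoD[OF Q_at_top]) auto
  then obtain z0 where z0: "\<And>z. z0 \<le> z \<Longrightarrow> 1 - \<epsilon> / M < Q z" by (auto simp: eventually_at_top_linorder)
  have "M - \<epsilon> \<le> V s k" if "z0 - \<theta> + \<mu>0 \<le> of_int k - s" for s k
    using z0[of "of_int k + \<theta> - s - \<mu>0"] that M_pos by (simp add: V_def field_simps)
  then show ?thesis by blast
qed

text \<open>
  For large \<open>s0\<close> the lattice points \<open>k + \<theta> - s0\<close> with \<open>k \<le> N\<close> lie far to the left of the bulk of the wave,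
  so there the initial left sums of the wave are at most \<open>\<epsilon>\<close>; for \<open>k \<ge> N\<close> the left sums of the
  solution are at least \<open>M - \<epsilon>\<close>. Comparison propagates the initial inequality.
\<close>

lemma V_le_U:
  assumes e: "0 < \<epsilon>"
  shows "\<exists>s0. \<forall>k. \<forall>t\<ge>0. V (clock s0 t) k \<le> U (of_int k + \<theta>) t + \<epsilon>"
proof -
  obtain N where N: "\<And>k. N \<le> k \<Longrightarrow> M - \<epsilon> \<le> U (of_int k + \<theta>) 0" using U_right_large[OF e] by blast
  obtain R where R: "\<And>s k. of_int k - s \<le> R \<Longrightarrow> V s k \<le> \<epsilon>" using V_small[OF e] by blast
  define s0 where "s0 = of_int N - R"
  have "V (clock s0 t) k \<le> U (of_int k + \<theta>) t + \<epsilon>" if "0 \<le> t" for k t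
  proof (rule cumulative_comparison[where v = "\<lambda>k t. V (clock s0 t) k" and u = "\<lambda>k. U (of_int k + \<theta>)"
        and c = "\<lambda>k t. exp (\<alpha> * t) * exp (- \<alpha> * (of_int k + \<theta> - 1))", OF _ _ _ _ _ _ _ that])
    fix k :: int and t :: real assume t: "0 \<le> t"
    show "(U (of_int k + \<theta>) has_real_derivative - (exp (\<alpha> * t) * exp (- \<alpha> * (of_int k + \<theta> - 1)))
        * (U (of_int k + \<theta>) t - U (of_int (k - 1) + \<theta>) t)\<^sup>2) (at t within {0..})"
      using U_deriv_upwind[OF t, of "of_int k + \<theta>"] by (simp add: algebra_simps)
    show "((\<lambda>t. V (clock s0 t) k) has_real_derivative - (exp (\<alpha> * t) * exp (- \<alpha> * (of_int k + \<theta> - 1)))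
        * (V (clock s0 t) k - V (clock s0 t) (k - 1))\<^sup>2) (at t within {0..})"
      by (rule V_deriv[OF t])
    show "U (of_int (k - 1) + \<theta>) t \<le> U (of_int k + \<theta>) t" by (rule U_mono_int[OF t]) simp
    show "V (clock s0 t) (k - 1) \<le> V (clock s0 t) k" by (rule V_mono) auto
  next
    fix T :: real
    have "V (clock s0 t) k \<le> U (of_int k + \<theta>) t + \<epsilon>" if "k \<le> N" "t \<in> {0..T}" for k t
    proof -
      have "s0 \<le> clock s0 t" using clock_ge that by auto
      moreover have "real_of_int k \<le> of_int N" using that by simp
      ultimately have "V (clock s0 t) k \<le> \<epsilon>" by (intro R) (simp add: s0_def)
      then show ?thesis using U_nonneg[of t "of_int k + \<theta>"] that by simp
    qed
    then show "\<exists>K. \<forall>k\<le>K. \<forall>t\<in>{0..T}. V (clock s0 t) k \<le> U (of_int k + \<theta>) t + \<epsilon>" by blast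
  next
    fix k
    show "V (clock s0 0) k \<le> U (of_int k + \<theta>) 0 + \<epsilon>"
    proof (cases "N \<le> k")
      case True
      then show ?thesis using N[OF True] V_le[of "clock s0 0" k] by linarith
    next
      case False
      then have "real_of_int k \<le> of_int N" by simp
      then have "V (clock s0 0) k \<le> \<epsilon>" by (intro R) (simp add: clock_0 s0_def)
      then show ?thesis using U_nonneg[of 0 "of_int k + \<theta>"] by simp
    qed
  qed auto
  then show ?thesis by blast
qed

text \<open>
  The mirror image: for \<open>s0\<close> close to \<open>-\<infinity>\<close> the wave starts with nearly all of its mass to the left of
  every position \<open>k \<ge> N\<close>, and for \<open>k \<le> N\<close> the left sums of the solution are at most \<open>\<epsilon>\<close>.
\<close>

lemma U_le_V:
  assumes e: "0 < \<epsilon>"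
  shows "\<exists>s0. \<forall>k. \<forall>t\<ge>0. U (of_int k + \<theta>) t \<le> V (clock s0 t) k + \<epsilon>"
proof -
  obtain N where N: "\<And>k. k \<le> N \<Longrightarrow> U (of_int k + \<theta>) 0 \<le> \<epsilon>"
    using U_left_small[OF e, of 0] by fastforce
  obtain R where R: "\<And>s k. R \<le> of_int k - s \<Longrightarrow> M - \<epsilon> \<le> V s k" using V_large[OF e] by blast
  define s0 where "s0 = of_int N - R"
  have "U (of_int k + \<theta>) t \<le> V (clock s0 t) k + \<epsilon>" if "0 \<le> t" for k t
  proof (rule cumulative_comparison[where u = "\<lambda>k t. V (clock s0 t) k" and v = "\<lambda>k. U (of_int k + \<theta>)"
        and c = "\<lambda>k t. exp (\<alpha> * t) * exp (- \<alpha> * (of_int k + \<theta> - 1))", OF _ _ _ _ _ _ _ that])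
    fix k :: int and t :: real assume t: "0 \<le> t"
    show "(U (of_int k + \<theta>) has_real_derivative - (exp (\<alpha> * t) * exp (- \<alpha> * (of_int k + \<theta> - 1)))
        * (U (of_int k + \<theta>) t - U (of_int (k - 1) + \<theta>) t)\<^sup>2) (at t within {0..})"
      using U_deriv_upwind[OF t, of "of_int k + \<theta>"] by (simp add: algebra_simps)
    show "((\<lambda>t. V (clock s0 t) k) has_real_derivative - (exp (\<alpha> * t) * exp (- \<alpha> * (of_int k + \<theta> - 1)))
        * (V (clock s0 t) k - V (clock s0 t) (k - 1))\<^sup>2) (at t within {0..})"
      by (rule V_deriv[OF t])
    show "U (of_int (k - 1) + \<theta>) t \<le> U (of_int k + \<theta>) t" by (rule U_mono_int[OF t]) simp
    show "V (clock s0 t) (k - 1) \<le> V (clock s0 t) k" by (rule V_mono) auto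
  next
    fix T :: real
    obtain K where K: "\<forall>k\<le>K. \<forall>t\<in>{0..T}. U (of_int k + \<theta>) t \<le> \<epsilon>"
      using U_left_small[OF e, of T] by blast
    have "U (of_int k + \<theta>) t \<le> V (clock s0 t) k + \<epsilon>" if "k \<le> K" "t \<in> {0..T}" for k t
    proof -
      have "U (of_int k + \<theta>) t \<le> \<epsilon>" using K that by blast
      then show ?thesis using V_nonneg[of "clock s0 t" k] by linarith
    qed
    then show "\<exists>K. \<forall>k\<le>K. \<forall>t\<in>{0..T}. U (of_int k + \<theta>) t \<le> V (clock s0 t) k + \<epsilon>" by blast
  next
    fix k
    show "U (of_int k + \<theta>) 0 \<le> V (clock s0 0) k + \<epsilon>"
    proof (cases "k \<le> N")
      case True
      then show ?thesis using N[OF True] V_nonneg[of "clock s0 0" k] by linarith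
    next
      case False
      then have "of_int N \<le> real_of_int k" by simp
      then have "M - \<epsilon> \<le> V (clock s0 0) k" by (intro R) (simp add: clock_0 s0_def)
      then show ?thesis using U_le_M[of 0 k] by simp
    qed
  qed auto
  then show ?thesis by blast
qed

text \<open>
  Since \<open>Q\<close> is Lipschitz, the asymptotically vanishing difference between the clocks is harmless,
  uniformly in \<open>k\<close>.
\<close>

lemma V_clock_close:
  assumes e: "0 < \<epsilon>"
  shows "\<forall>\<^sub>F t in at_top. \<forall>k. \<bar>V (clock s0 t) k - V t k\<bar> \<le> \<epsilon>"
proof -
  have "((\<lambda>t. M * (B * \<bar>clock s0 t - t\<bar>)) \<longlongrightarrow> 0) at_top"
    by (intro tendsto_mult_right_zero tendsto_rabs_zero clock_asymp)
  then have "\<forall>\<^sub>F t in at_top. M * (B * \<bar>clock s0 t - t\<bar>) < \<epsilon>" using e by (rule order_tendstoD)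
  then show ?thesis
  proof eventually_elim
    case (elim t)
    have "\<bar>V (clock s0 t) k - V t k\<bar> \<le> \<epsilon>" for k
    proof -
      let ?a = "of_int k + \<theta> - clock s0 t - \<mu>0" and ?b = "of_int k + \<theta> - t - \<mu>0"
      have "\<bar>V (clock s0 t) k - V t k\<bar> = M * \<bar>Q ?a - Q ?b\<bar>"
        using M_pos by (simp add: V_def abs_mult flip: right_diff_distrib)
      also have "\<dots> \<le> M * (B * \<bar>?a - ?b\<bar>)" by (rule mult_left_mono[OF Q_lipschitz]) (use M_pos in simp)
      finally show ?thesis using elim by (simp add: abs_minus_commute)
    qed
    then show ?case by blast
  qed
qed

text \<open>
  The solution is squeezed, up to \<open>\<epsilon> / 2\<close>, between two copies of the wave whose clocks agree with \<open>t\<close>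
  asymptotically.
\<close>

lemma U_uniformly_close:
  assumes e: "0 < \<epsilon>"
  shows "\<forall>\<^sub>F t in at_top. \<forall>k. \<bar>U (of_int k + \<theta>) t - V t k\<bar> \<le> \<epsilon>"
proof -
  obtain s1 where s1: "\<And>k t. 0 \<le> t \<Longrightarrow> V (clock s1 t) k \<le> U (of_int k + \<theta>) t + \<epsilon> / 2"
    using V_le_U[of "\<epsilon> / 2"] e by auto
  obtain s2 where s2: "\<And>k t. 0 \<le> t \<Longrightarrow> U (of_int k + \<theta>) t \<le> V (clock s2 t) k + \<epsilon> / 2"
    using U_le_V[of "\<epsilon> / 2"] e by auto
  have e2: "0 < \<epsilon> / 2" using e by simp
  show ?thesis
    using V_clock_close[OF e2, of s1] V_clock_close[OF e2, of s2] eventually_ge_at_top[of 0]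
  proof eventually_elim
    case (elim t)
    have "\<bar>U (of_int k + \<theta>) t - V t k\<bar> \<le> \<epsilon>" for k
      using s1[OF elim(3), of k] s2[OF elim(3), of k] elim(1)[rule_format, of k] elim(2)[rule_format, of k]
      by linarith
    then show ?case by blast
  qed
qed

definition G :: "real \<Rightarrow> real" where "G x = M * w (x - \<mu>0)"

lemma G_nonneg: "0 \<le> G x" using M_pos w_nonneg by (simp add: G_def)

lemma G_eq: "G x = exp (\<alpha> * x) * p (x - \<mu>0)"
proof -
  have "M * exp (\<alpha> * (x - \<mu>0)) = exp (\<alpha> * x)"
    by (simp only: M_eq) (simp add: algebra_simps flip: exp_add)
  then show ?thesis by (simp add: G_def w_def flip: mult.assoc)
qed

lemma G_le: "G x \<le> B * exp (\<alpha> * x)"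
  using le[of "x - \<mu>0"] by (simp add: G_eq mult.commute)

lemma left_sum_G: "left_sum G z = M * Q (z - \<mu>0)"
proof -
  have "left_sum G z = (\<Sum>n. M * w (z - \<mu>0 - 1 - real n))"
    by (simp add: left_sum_def G_def algebra_simps)
  also have "\<dots> = M * Q (z - \<mu>0)"
    unfolding left_sum_def by (rule suminf_mult[OF summable_lattice[OF w_bounds]])
  finally show ?thesis .
qed

lemma total_G: "(\<integral>\<^sup>+ k. ennreal (G (of_int k + z)) \<partial>count_space (UNIV :: int set)) = ennreal M"
proof -
  have "(\<integral>\<^sup>+ k. ennreal (G (of_int k + z)) \<partial>count_space (UNIV :: int set))
    = (\<integral>\<^sup>+ k. ennreal M * ennreal (w (of_int k + (z - \<mu>0))) \<partial>count_space (UNIV :: int set))"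
    using M_pos by (intro nn_integral_cong) (simp add: G_def ennreal_mult' algebra_simps)
  also have "\<dots> = ennreal M" by (simp add: nn_integral_cmult lattice_mass)
  finally show ?thesis .
qed

text \<open>
  The window of \<open>lattice_l1_distance_le\<close> moves with the wave and has a length that depends only on
  the tolerated loss of mass; so the closeness of the left sums may be chosen after it.
\<close>

lemma lattice_convergence:
  "((\<lambda>t. \<integral>\<^sup>+ k. ennreal \<bar>W t (of_int k + (\<theta> - t)) - G (of_int k + (\<theta> - t))\<bar> \<partial>count_space (UNIV :: int set))
    \<longlongrightarrow> 0) at_top"
proof (rule order_tendstoI)
  fix \<eta>' :: ennreal assume "0 < \<eta>'"
  then obtain \<eta> where \<eta>: "0 < ennreal \<eta>" "ennreal \<eta> < \<eta>'" by (metis ennreal_cases dense infinity_ennreal_def not_top_less less_top)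
  then have \<eta>0: "0 < \<eta>" by simp
  obtain R1 where R1: "\<And>s k. of_int k - s \<le> R1 \<Longrightarrow> V s k \<le> \<eta> / 8"
    using V_small[of "\<eta> / 8"] \<eta>0 by auto
  obtain R2 where R2: "\<And>s k. R2 \<le> of_int k - s \<Longrightarrow> M - \<eta> / 8 \<le> V s k"
    using V_large[of "\<eta> / 8"] \<eta>0 by auto
  \<comment> \<open>The window is \<open>{a..<a + n}\<close> with \<open>a = \<lfloor>t + R1\<rfloor>\<close>; the summand \<open>1\<close> makes up for the floor.\<close>
  define n where "n = \<bar>\<lceil>R2 - R1\<rceil>\<bar> + 1"
  define \<epsilon> where "\<epsilon> = \<eta> / (8 * of_int n)"
  have n: "1 \<le> n" "R2 - R1 + 1 \<le> of_int n" unfolding n_def by linarith+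
  have \<epsilon>: "0 < \<epsilon>" "of_int n * (2 * \<epsilon>) = \<eta> / 4" using n \<eta>0 by (auto simp: \<epsilon>_def)
  show "\<forall>\<^sub>F t in at_top. (\<integral>\<^sup>+ k. ennreal \<bar>W t (of_int k + (\<theta> - t)) - G (of_int k + (\<theta> - t))\<bar>
      \<partial>count_space (UNIV :: int set)) < \<eta>'"
    using U_uniformly_close[OF \<epsilon>(1)] eventually_ge_at_top[of 0]
  proof eventually_elim
    case (elim t)
    obtain D where D: "\<And>s x. s \<in> {0..t} \<Longrightarrow> W s x \<le> D * exp (\<alpha> * x)" using W_bound by blast
    define a where "a = \<lfloor>t + R1\<rfloor>"
    define b where "b = a + n"
    have Gsum: "left_sum G (of_int k + (\<theta> - t)) = V t k" for k
      by (simp add: left_sum_G V_def algebra_simps)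
    have Va: "V t a \<le> \<eta> / 8" by (rule R1) (simp add: a_def; linarith)
    have Vb: "M - \<eta> / 8 \<le> V t b" 
    proof (rule R2)
      have "t + R1 - 1 \<le> of_int a" unfolding a_def by linarith
      then show "R2 \<le> of_int b - t" using n by (simp add: b_def)
    qed
    have "(\<integral>\<^sup>+ k. ennreal \<bar>W t (of_int k + (\<theta> - t)) - G (of_int k + (\<theta> - t))\<bar> \<partial>count_space (UNIV :: int set))
      \<le> ennreal (2 * (of_int (b - a) * (2 * \<epsilon>)
        + (M - (left_sum G (of_int b + (\<theta> - t)) - left_sum G (of_int a + (\<theta> - t))))))"
    proof (rule lattice_l1_distance_le[OF \<alpha> W_nonneg[OF elim(2)] _ G_nonneg G_le _ total_G])
      show "W t x \<le> D * exp (\<alpha> * x)" for x using D elim(2) by auto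
      show "(\<integral>\<^sup>+ k. ennreal (W t (of_int k + (\<theta> - t))) \<partial>count_space (UNIV :: int set)) \<le> ennreal M"
        using mass_le[OF elim(2), of \<theta>] mass_M by simp
      show "\<bar>left_sum (W t) (of_int k + (\<theta> - t)) - left_sum G (of_int k + (\<theta> - t))\<bar> \<le> \<epsilon>" for k
        using elim(1)[rule_format, of k] unfolding Gsum by (simp add: U_def algebra_simps)
    qed (use M_pos n in \<open>auto simp: b_def\<close>)
    also have "\<dots> \<le> ennreal \<eta>"
    proof (rule ennreal_leI)
      have width: "of_int (b - a) * (2 * \<epsilon>) = \<eta> / 4" using \<epsilon>(2) by (simp add: b_def)
      have "2 * (\<eta> / 4 + (M - (V t b - V t a))) \<le> \<eta>"
        using Va Vb by (simp add: field_simps)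
      then show "2 * (of_int (b - a) * (2 * \<epsilon>)
        + (M - (left_sum G (of_int b + (\<theta> - t)) - left_sum G (of_int a + (\<theta> - t))))) \<le> \<eta>"
        by (simp only: Gsum width)
    qed
    finally show ?case using \<eta>(2) by (rule le_less_trans)
  qed
qed simp

end

section \<open>Measurability of the solution\<close>

text \<open>
  The explicit Euler scheme for \<open>H' y = F (H y) (H (y - 1))\<close>, where \<open>H t y = h t (y - t)\<close> is the solution on
  the characteristic that starts in \<open>y\<close>. Every iterate is measurable in \<open>y\<close>.
\<close>

primrec euler :: "(real \<Rightarrow> real \<Rightarrow> real) \<Rightarrow> (real \<Rightarrow> real) \<Rightarrow> real \<Rightarrow> nat \<Rightarrow> real \<Rightarrow> real" where
  "euler F f \<delta> 0 y = f y"
| "euler F f \<delta> (Suc j) y = euler F f \<delta> j y + \<delta> * F (euler F f \<delta> j y) (euler F f \<delta> j (y - 1))"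

context evolution
begin

definition reaction :: "real \<Rightarrow> real \<Rightarrow> real" where "reaction a b = \<alpha> * a + exp (- \<alpha>) * b\<^sup>2 - a\<^sup>2"

lemma evol_rhs_eq: "evol_rhs \<alpha> h y t = reaction (h t (y - t)) (h t (y - 1 - t))"
proof -
  have "y - t - 1 = y - 1 - t" by simp
  then show ?thesis unfolding evol_rhs_def reaction_def by (simp only:)
qed

lemma reaction_lipschitz:
  assumes a: "a \<in> {0..B}" "a' \<in> {0..B}" "\<bar>a - a'\<bar> \<le> d" and b: "b \<in> {0..B}" "b' \<in> {0..B}" "\<bar>b - b'\<bar> \<le> d"
  shows "\<bar>reaction a b - reaction a' b'\<bar> \<le> (\<alpha> + 4 * B) * d"
proof -
  have sq: "\<bar>u\<^sup>2 - v\<^sup>2\<bar> \<le> 2 * B * d" if "u \<in> {0..B}" "v \<in> {0..B}" "\<bar>u - v\<bar> \<le> d" for u v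
  proof -
    have "\<bar>u\<^sup>2 - v\<^sup>2\<bar> = (u + v) * \<bar>u - v\<bar>"
      using that by (simp add: square_diff_square_factored power2_eq_square abs_mult)
    also have "\<dots> \<le> (2 * B) * d" using that by (intro mult_mono) auto
    finally show ?thesis .
  qed
  have "\<bar>\<alpha> * (a - a')\<bar> \<le> \<alpha> * d" using a \<alpha>_pos by (simp add: abs_mult)
  moreover have "\<bar>exp (- \<alpha>) * (b\<^sup>2 - b'\<^sup>2)\<bar> \<le> 1 * (2 * B * d)"
    unfolding abs_mult using sq[OF b] \<alpha>_pos by (intro mult_mono) auto
  moreover have "\<bar>a\<^sup>2 - a'\<^sup>2\<bar> \<le> 2 * B * d" by (rule sq[OF a])
  moreover have "reaction a b - reaction a' b' = \<alpha> * (a - a') + exp (- \<alpha>) * (b\<^sup>2 - b'\<^sup>2) - (a\<^sup>2 - a'\<^sup>2)"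
    by (simp add: reaction_def algebra_simps)
  moreover have "(\<alpha> + 4 * B) * d = \<alpha> * d + 1 * (2 * B * d) + 2 * B * d" by (simp add: algebra_simps)
  ultimately show ?thesis by linarith
qed

lemma reaction_0: "reaction 0 0 = 0" by (simp add: reaction_def)

lemma reaction_bound:
  assumes "a \<in> {0..B}" "b \<in> {0..B}" shows "\<bar>reaction a b\<bar> \<le> (\<alpha> + 4 * B) * B"
  using reaction_lipschitz[of a B 0 B b 0] assms by (simp add: reaction_0)

lemma h_euler_step:
  assumes B: "\<And>t x. t \<in> {0..T} \<Longrightarrow> h t x \<in> {0..B}" and s: "0 \<le> s" and \<delta>: "0 < \<delta>" "s + \<delta> \<le> T"
  defines "K \<equiv> \<alpha> + 4 * B"
  shows "\<bar>h (s + \<delta>) (y - (s + \<delta>)) - h s (y - s) - \<delta> * reaction (h s (y - s)) (h s (y - 1 - s))\<bar> \<le> K * (K * B) * \<delta>\<^sup>2"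
proof -
  let ?H = "\<lambda>t y. h t (y - t)"
  have mvt: "\<exists>r\<in>{s<..<t}. ?H t y - ?H s y = reaction (?H r y) (?H r (y - 1)) * (t - s)"
    if "s < t" "t \<le> s + \<delta>" for t y
  proof (rule mvt_simple[OF that(1)])
    fix r assume "s \<le> r" "r \<le> t"
    then show "((\<lambda>t. ?H t y) has_derivative (*) (reaction (?H r y) (?H r (y - 1)))) (at r within {s..t})"
      unfolding has_field_derivative_def[symmetric] evol_rhs_eq[symmetric]
      by (intro DERIV_subset[OF h_deriv]) (use s in auto)
  qed
  have close: "\<bar>?H r y - ?H s y\<bar> \<le> K * B * \<delta>" if r: "s < r" "r \<le> s + \<delta>" for r y
  proof -
    obtain q where q: "q \<in> {s<..<r}" "?H r y - ?H s y = reaction (?H q y) (?H q (y - 1)) * (r - s)"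
      using mvt[OF r] by blast
    have "\<bar>reaction (?H q y) (?H q (y - 1))\<bar> \<le> K * B"
      unfolding K_def by (rule reaction_bound) (rule B, use q r s \<delta> in simp)+
    then have "\<bar>reaction (?H q y) (?H q (y - 1))\<bar> * \<bar>r - s\<bar> \<le> (K * B) * \<delta>"
      using r by (intro mult_mono) auto
    then show ?thesis unfolding q(2) abs_mult .
  qed
  obtain r where r: "r \<in> {s<..<s + \<delta>}"
    "?H (s + \<delta>) y - ?H s y = reaction (?H r y) (?H r (y - 1)) * (s + \<delta> - s)"
    using mvt[of "s + \<delta>" y] \<delta> by auto
  have "\<bar>reaction (?H r y) (?H r (y - 1)) - reaction (?H s y) (?H s (y - 1))\<bar> \<le> K * (K * B * \<delta>)"
    unfolding K_def
  proof (rule reaction_lipschitz)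
    show "?H r y \<in> {0..B}" "?H r (y - 1) \<in> {0..B}" "?H s y \<in> {0..B}" "?H s (y - 1) \<in> {0..B}"
      using r(1) s \<delta> by (intro B; simp)+
    show "\<bar>?H r y - ?H s y\<bar> \<le> (\<alpha> + 4 * B) * B * \<delta>" "\<bar>?H r (y - 1) - ?H s (y - 1)\<bar> \<le> (\<alpha> + 4 * B) * B * \<delta>"
      using close[of r] r(1) unfolding K_def by simp_all
  qed
  then have "\<delta> * \<bar>reaction (?H r y) (?H r (y - 1)) - reaction (?H s y) (?H s (y - 1))\<bar> \<le> \<delta> * (K * (K * B * \<delta>))"
    using \<delta> by (intro mult_left_mono) auto
  moreover have "?H (s + \<delta>) y - ?H s y - \<delta> * reaction (?H s y) (?H s (y - 1))
      = \<delta> * (reaction (?H r y) (?H r (y - 1)) - reaction (?H s y) (?H s (y - 1)))"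
    unfolding r(2) by (simp add: algebra_simps)
  ultimately show ?thesis using \<delta> by (simp add: abs_mult power2_eq_square mult_ac)
qed

text \<open>
  The usual induction for a one-step method. The right-hand side is only locally Lipschitz, so its
  arguments are clipped to the range \<open>{0..B}\<close> of the solution; this does not increase the distance to the
  solution. The crude factor \<open>real j\<close> in the bound keeps the induction free of geometric sums.
\<close>

lemma h_euler_error:
  assumes B: "\<And>t x. t \<in> {0..T} \<Longrightarrow> h t x \<in> {0..B}" and \<delta>: "0 < \<delta>" and j: "real j * \<delta> \<le> T"
  defines "K \<equiv> \<alpha> + 4 * B" and "F \<equiv> \<lambda>a b. reaction (min B (max 0 a)) (min B (max 0 b))"
  shows "\<bar>h (real j * \<delta>) (y - real j * \<delta>) - euler F h0 \<delta> j y\<bar> \<le> real j * (1 + K * \<delta>) ^ j * (K * (K * B) * \<delta>\<^sup>2)"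
  using j
proof (induction j arbitrary: y)
  case 0
  then show ?case by (simp add: h_init)
next
  case (Suc j)
  let ?s = "real j * \<delta>"
  let ?C = "K * (K * B) * \<delta>\<^sup>2" and ?q = "1 + K * \<delta>"
  let ?b = "real j * ?q ^ j * ?C"
  let ?H = "\<lambda>t y. h t (y - t)"
  let ?E = "euler F h0 \<delta> j"
  have T: "?s + \<delta> \<le> T" using Suc.prems by (simp add: algebra_simps)
  then have s: "0 \<le> ?s" "?s \<le> T" using \<delta> by auto
  have Suc_s: "real (Suc j) * \<delta> = ?s + \<delta>" by (simp add: algebra_simps)
  have Bs: "?H ?s y \<in> {0..B}" for y by (rule B) (use s in auto)
  have B0: "0 \<le> B" using Bs[of 0] by simp
  have K0: "0 \<le> K" unfolding K_def using B0 \<alpha>_pos by simp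
  have IH: "\<bar>?H ?s y - ?E y\<bar> \<le> ?b" for y by (rule Suc.IH[OF s(2)])
  have clip: "\<bar>?H ?s y - min B (max 0 (?E y))\<bar> \<le> ?b" for y
  proof -
    have "\<bar>a - min B (max 0 e)\<bar> \<le> \<bar>a - e\<bar>" if "a \<in> {0..B}" for a e :: real
      using that by (auto simp: min_def max_def)
    from order_trans[OF this[OF Bs] IH] show ?thesis .
  qed
  have reaction: "\<bar>reaction (?H ?s y) (?H ?s (y - 1)) - F (?E y) (?E (y - 1))\<bar> \<le> K * ?b" for y
    unfolding K_def F_def
    by (rule reaction_lipschitz[OF Bs _ clip[unfolded K_def F_def] Bs _ clip[unfolded K_def F_def]]) (use B0 in auto)
  have step: "\<bar>?H (?s + \<delta>) y - ?H ?s y - \<delta> * reaction (?H ?s y) (?H ?s (y - 1))\<bar> \<le> ?C"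
    unfolding K_def by (rule h_euler_step[OF B s(1) \<delta> T])
  have "\<delta> * \<bar>reaction (?H ?s y) (?H ?s (y - 1)) - F (?E y) (?E (y - 1))\<bar> \<le> \<delta> * (K * ?b)"
    using reaction \<delta> by (intro mult_left_mono) auto
  then have "\<bar>\<delta> * (reaction (?H ?s y) (?H ?s (y - 1)) - F (?E y) (?E (y - 1)))\<bar> \<le> \<delta> * (K * ?b)"
    using \<delta> by (simp add: abs_mult)
  moreover have "?H (?s + \<delta>) y - euler F h0 \<delta> (Suc j) y
      = (?H (?s + \<delta>) y - ?H ?s y - \<delta> * reaction (?H ?s y) (?H ?s (y - 1)))
        + (?H ?s y - ?E y) + \<delta> * (reaction (?H ?s y) (?H ?s (y - 1)) - F (?E y) (?E (y - 1)))"
    by (simp add: algebra_simps)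
  ultimately have "\<bar>?H (?s + \<delta>) y - euler F h0 \<delta> (Suc j) y\<bar> \<le> ?C + ?b + \<delta> * (K * ?b)"
    using step IH[of y] by linarith
  also have "\<dots> = 1 * ?C + real j * ?q ^ Suc j * ?C" by (simp add: algebra_simps)
  also have "\<dots> \<le> ?q ^ Suc j * ?C + real j * ?q ^ Suc j * ?C"
  proof -
    have "1 \<le> ?q ^ Suc j" using K0 \<delta> by (intro one_le_power) auto
    moreover have "0 \<le> ?C" using K0 B0 by simp
    ultimately show ?thesis by (intro add_mono mult_right_mono) auto
  qed
  also have "\<dots> = real (Suc j) * ?q ^ Suc j * ?C" by (simp add: algebra_simps)
  finally show ?case unfolding Suc_s .
qed

lemma euler_measurable:
  assumes f: "f \<in> borel_measurable lebesgue"
  shows "euler (\<lambda>a b. reaction (min B (max 0 a)) (min B (max 0 b))) f \<delta> j \<in> borel_measurable lebesgue"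
    (is "euler ?F f \<delta> j \<in> _")
proof (induction j)
  case 0
  have "euler ?F f \<delta> 0 = f" by (rule ext) simp
  then show ?case using f by simp
next
  case (Suc j)
  have F: "(\<lambda>y. e y + \<delta> * ?F (e y) (e' y)) \<in> borel_measurable lebesgue"
    if [measurable]: "e \<in> borel_measurable lebesgue" "e' \<in> borel_measurable lebesgue" for e e' :: "real \<Rightarrow> real"
    unfolding reaction_def by measurable
  have shifted: "(\<lambda>y. euler ?F f \<delta> j (y - 1)) \<in> borel_measurable lebesgue"
    using measurable_lebesgue_shift[OF Suc, of "- 1"] by simp
  have "euler ?F f \<delta> (Suc j) = (\<lambda>y. euler ?F f \<delta> j y + \<delta> * ?F (euler ?F f \<delta> j y) (euler ?F f \<delta> j (y - 1)))"
    by (rule ext) simp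
  also have "\<dots> \<in> borel_measurable lebesgue" by (rule F[OF Suc shifted])
  finally show ?case .
qed

text \<open>
  With \<open>n + 1\<close> steps of length \<open>t / (n + 1)\<close> the Euler error is of order \<open>1 / (n + 1)\<close>.
\<close>

lemma h_measurable:
  assumes h0: "h0 \<in> borel_measurable lebesgue" and t: "0 \<le> t"
  shows "h t \<in> borel_measurable lebesgue"
proof (cases "t = 0")
  case True
  have "h 0 = h0" by (rule ext) (rule h_init)
  then show ?thesis using h0 True by simp
next
  case False
  obtain B where B: "0 < B" "\<And>s x. s \<in> {0..t} \<Longrightarrow> h s x \<le> B" using h_bound by blast
  have B': "h s x \<in> {0..B}" if "s \<in> {0..t}" for s x using B(2)[OF that] h_nonneg that by auto
  define K where "K = \<alpha> + 4 * B"
  define F where "F = (\<lambda>a b. reaction (min B (max 0 a)) (min B (max 0 b)))"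
  define E where "E n = euler F h0 (t / real (Suc n)) (Suc n)" for n
  have err: "\<bar>h t (y - t) - E n y\<bar> \<le> exp (K * t) * (K * (K * B) * t\<^sup>2) / real (Suc n)" for n y
  proof -
    let ?n = "real (Suc n)" and ?\<delta> = "t / real (Suc n)"
    have n: "?n * ?\<delta> = t" by simp
    have C: "0 \<le> K * (K * B)" using B(1) \<alpha>_pos by (simp add: K_def)
    have "\<bar>h t (y - t) - E n y\<bar> \<le> ?n * (1 + K * ?\<delta>) ^ Suc n * (K * (K * B) * ?\<delta>\<^sup>2)"
    proof -
      have "0 < ?\<delta>" using t False by simp
      from h_euler_error[OF B' this, of t "Suc n" y] show ?thesis
        unfolding n K_def F_def E_def by blast
    qed
    also have "\<dots> \<le> ?n * exp (K * t) * (K * (K * B) * ?\<delta>\<^sup>2)"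
    proof -
      have "(1 + K * ?\<delta>) ^ Suc n \<le> exp (K * ?\<delta>) ^ Suc n"
        using B(1) \<alpha>_pos t by (intro power_mono exp_ge_add_one_self) (auto simp: K_def)
      also have "\<dots> = exp (?n * (K * ?\<delta>))" by (rule exp_of_nat_mult[symmetric])
      also have "?n * (K * ?\<delta>) = K * t" by (simp add: field_simps)
      finally show ?thesis using C by (intro mult_right_mono mult_left_mono) auto
    qed
    also have "\<dots> = exp (K * t) * (K * (K * B) * t\<^sup>2) / ?n"
      by (simp add: power_divide power2_eq_square)
    finally show ?thesis .
  qed
  have lim: "(\<lambda>n. E n y) \<longlonglongrightarrow> h t (y - t)" for y
  proof -
    have "(\<lambda>n. exp (K * t) * (K * (K * B) * t\<^sup>2) / real (Suc n)) \<longlonglongrightarrow> 0"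
      by (rule LIMSEQ_Suc) (rule lim_const_over_n)
    then have "(\<lambda>n. h t (y - t) - E n y) \<longlonglongrightarrow> 0"
      by (rule Lim_null_comparison[rotated]) (use err in auto)
    from tendsto_diff[OF tendsto_const[of "h t (y - t)"] this] show ?thesis by simp
  qed
  have "(\<lambda>y. h t (y - t)) \<in> borel_measurable lebesgue"
    by (rule borel_measurable_LIMSEQ_real[OF lim]) (unfold E_def F_def, rule euler_measurable[OF h0])
  from measurable_lebesgue_shift[OF this, of t] show ?thesis by simp
qed

end

section \<open>Integration over all lattices\<close>

text \<open>
  The mass of a lattice depends only on the lattice; with this the fractional part in \<^const>\<open>\<mu>\<close> disappears.
\<close>

lemma m0_periodic: "m0 \<alpha> h0 (frac x) = m0 \<alpha> h0 x"
  using nn_integral_int_shift[of "\<lambda>k. ennreal (exp (\<alpha> * (of_int k + frac x)) * h0 (of_int k + frac x))" "\<lfloor>x\<rfloor>"]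
  unfolding m0_def by (simp add: frac_def)

lemma m0_shift: "m0 \<alpha> h0 (t + (of_int k + (\<theta> - t))) = m0 \<alpha> h0 \<theta>"
proof -
  have "t + (of_int k + (\<theta> - t)) = of_int k + \<theta>" by simp
  moreover have "frac (of_int k + \<theta>) = frac \<theta>" by (simp add: frac_def)
  ultimately show ?thesis by (metis m0_periodic)
qed

lemma m0_measurable:
  assumes "h0 \<in> borel_measurable lebesgue"
  shows "m0 \<alpha> h0 \<in> borel_measurable lebesgue"
proof -
  have "(\<lambda>\<theta>. ennreal (exp (\<alpha> * (of_int k + \<theta>)) * h0 (of_int k + \<theta>))) \<in> borel_measurable lebesgue" for k :: int
  proof -
    have "(\<lambda>\<theta>. h0 (of_int k + \<theta>)) \<in> borel_measurable lebesgue"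
      using measurable_lebesgue_shift[OF assms, of "of_int k"] by (simp add: add.commute)
    moreover have "(\<lambda>\<theta>. exp (\<alpha> * (of_int k + \<theta>))) \<in> borel_measurable lebesgue"
      by (intro measurable_completion) measurable
    ultimately show ?thesis by measurable
  qed
  then show ?thesis
    unfolding m0_def[abs_def] by (rule borel_measurable_count_space_nn_integral)
qed

lemma profile_ext_minus_\<mu>:
  assumes "0 < \<alpha>"
  shows "profile_ext p (ereal x - \<mu> \<alpha> h0 t x) =
    (if m0 \<alpha> h0 (t + x) = 0 then Lim at_top p else if m0 \<alpha> h0 (t + x) = \<infinity> then Lim at_bot p
     else p (x - ln (enn2real (m0 \<alpha> h0 (t + x))) / \<alpha>))"
  by (simp add: profile_ext_def \<mu>_def m0_periodic Let_def)

text \<open>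
  The limit of the profile at \<open>\<infinity>\<close> is the value of \<open>profile_ext\<close> on lattices without mass, where the
  solution vanishes.
\<close>

locale evolution_with_wave = evolution \<alpha> h0 h + stationary_wave \<alpha> B p
  for \<alpha> h0 h B p +
  assumes p_at_top: "(p \<longlongrightarrow> 0) at_top"
    and h0_measurable: "h0 \<in> borel_measurable lebesgue"
begin

definition target :: "real \<Rightarrow> real \<Rightarrow> real" where "target t x = profile_ext p (ereal x - \<mu> \<alpha> h0 t x)"

lemma target_eq:
  "target t x = (if m0 \<alpha> h0 (t + x) = 0 then 0 else if m0 \<alpha> h0 (t + x) = \<infinity> then Lim at_bot p
     else p (x - ln (enn2real (m0 \<alpha> h0 (t + x))) / \<alpha>))"
  unfolding target_def profile_ext_minus_\<mu>[OF \<alpha>] using tendsto_Lim[OF _ p_at_top] by simp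

lemma target_measurable: "target t \<in> borel_measurable lebesgue"
proof -
  have [measurable]: "(\<lambda>x. m0 \<alpha> h0 (t + x)) \<in> borel_measurable lebesgue"
    using measurable_lebesgue_shift[OF m0_measurable[OF h0_measurable], of \<alpha> t] by (simp add: add.commute)
  have [measurable]: "(\<lambda>x::real. x) \<in> borel_measurable lebesgue"
    by (intro measurable_completion) measurable
  have "target t = (\<lambda>x. if m0 \<alpha> h0 (t + x) = 0 then 0 else if m0 \<alpha> h0 (t + x) = \<infinity> then Lim at_bot p
     else p (x - ln (enn2real (m0 \<alpha> h0 (t + x))) / \<alpha>))"
    by (rule ext) (rule target_eq)
  also have "\<dots> \<in> borel_measurable lebesgue" by measurable
  finally show ?thesis .
qed

lemma integrand_measurable:
  assumes "0 \<le> t"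
  shows "(\<lambda>x. exp (\<alpha> * x) * \<bar>h t x - target t x\<bar>) \<in> borel_measurable lebesgue"
proof -
  note [measurable] = h_measurable[OF h0_measurable assms] target_measurable
  have [measurable]: "(\<lambda>x::real. exp (\<alpha> * x)) \<in> borel_measurable lebesgue"
    by (intro measurable_completion) measurable
  show ?thesis by measurable
qed

text \<open>
  The weighted distance between the solution and its target on the lattice \<open>\<int> + \<theta> - t\<close>, which
  carries the characteristics that start in \<open>\<int> + \<theta>\<close>.
\<close>

definition lattice_dist :: "real \<Rightarrow> real \<Rightarrow> ennreal" where
  "lattice_dist t \<theta> = (\<integral>\<^sup>+ k. ennreal (exp (\<alpha> * (of_int k + (\<theta> - t))) * \<bar>h t (of_int k + (\<theta> - t)) - target t (of_int k + (\<theta> - t))\<bar>)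
     \<partial>count_space (UNIV :: int set))"

lemma nn_integral_eq_lattice_dist:
  assumes "0 \<le> t"
  shows "(\<integral>\<^sup>+ x. ennreal (exp (\<alpha> * x) * \<bar>h t x - target t x\<bar>) \<partial>lebesgue) = (\<integral>\<^sup>+ \<theta> \<in> {0..<1}. lattice_dist t \<theta> \<partial>lebesgue)"
proof -
  let ?I = "\<lambda>x. ennreal (exp (\<alpha> * x) * \<bar>h t x - target t x\<bar>)"
  have I: "?I \<in> borel_measurable lebesgue" using integrand_measurable[OF assms] by measurable
  have "(\<integral>\<^sup>+ x. ?I x \<partial>lebesgue) = (\<integral>\<^sup>+ x. ?I (x + - t) \<partial>lebesgue)"
    by (rule nn_integral_lebesgue_shift[OF I, symmetric])
  also have "\<dots> = (\<integral>\<^sup>+ \<theta> \<in> {0..<1}. (\<integral>\<^sup>+ k. ?I (of_int k + \<theta> + - t) \<partial>count_space (UNIV :: int set)) \<partial>lebesgue)"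
    by (rule nn_integral_lebesgue_periodize[OF measurable_lebesgue_shift[OF I]])
  also have "\<dots> = (\<integral>\<^sup>+ \<theta> \<in> {0..<1}. lattice_dist t \<theta> \<partial>lebesgue)"
    by (simp add: lattice_dist_def add_diff_eq)
  finally show ?thesis .
qed

lemma lattice_dist_measurable:
  assumes "0 \<le> t" shows "lattice_dist t \<in> borel_measurable lebesgue"
proof -
  let ?I = "\<lambda>x. ennreal (exp (\<alpha> * x) * \<bar>h t x - target t x\<bar>)"
  have I: "?I \<in> borel_measurable lebesgue" using integrand_measurable[OF assms] by measurable
  have "(\<lambda>\<theta>. ?I (of_int k + (\<theta> - t))) \<in> borel_measurable lebesgue" for k :: int
    using measurable_lebesgue_shift[OF I, of "of_int k - t"] by (simp add: algebra_simps)
  then show ?thesis unfolding lattice_dist_def[abs_def] by (rule borel_measurable_count_space_nn_integral)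
qed

lemma target_on_lattice_zero: "m0 \<alpha> h0 \<theta> = 0 \<Longrightarrow> target t (of_int k + (\<theta> - t)) = 0"
  by (simp only: target_eq m0_shift) simp

lemma lattice_dist_eq:
  assumes M: "m0 \<alpha> h0 \<theta> = ennreal M" "0 < M" and t: "0 \<le> t"
  shows "lattice_dist t \<theta> = (\<integral>\<^sup>+ k. ennreal \<bar>W t (of_int k + (\<theta> - t)) -
    exp (\<alpha> * (of_int k + (\<theta> - t))) * p (of_int k + (\<theta> - t) - ln M / \<alpha>)\<bar> \<partial>count_space (UNIV :: int set))"
proof -
  have "target t (of_int k + (\<theta> - t)) = p (of_int k + (\<theta> - t) - ln M / \<alpha>)" for k
    using M by (simp only: target_eq m0_shift) simp
  then show ?thesis
    unfolding lattice_dist_def W_def right_diff_distrib[symmetric] abs_mult by simp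
qed

lemma relaxation_at:
  assumes M: "m0 \<alpha> h0 \<theta> = ennreal M" "0 < M"
  shows "relaxation \<alpha> h0 h B p \<theta> M (ln M / \<alpha>)"
  by unfold_locales (use M \<alpha> in auto)

text \<open>
  Both families have at most the mass \<open>m0 \<alpha> h0 \<theta>\<close>. In the case \<open>m0 \<alpha> h0 \<theta> = 0\<close> this bound already says
  that the distance vanishes at all times.
\<close>

lemma lattice_dist_le: assumes t: "0 \<le> t" shows "lattice_dist t \<theta> \<le> m0 \<alpha> h0 \<theta> + m0 \<alpha> h0 \<theta>"
proof (cases "m0 \<alpha> h0 \<theta>")
  case (real M)
  show ?thesis
  proof (cases "M = 0")
    case True
    then have "lattice_dist t \<theta> = (\<integral>\<^sup>+ k. ennreal (W t (of_int k + (\<theta> - t))) \<partial>count_space (UNIV :: int set))"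
      using real h_nonneg[OF t] by (simp add: lattice_dist_def target_on_lattice_zero W_def)
    also have "\<dots> \<le> m0 \<alpha> h0 \<theta>" by (rule mass_le[OF t])
    finally show ?thesis using real True by simp
  next
    case False
    with real have M: "m0 \<alpha> h0 \<theta> = ennreal M" "0 < M" by auto
    interpret r: relaxation \<alpha> h0 h B p \<theta> M "ln M / \<alpha>" by (rule relaxation_at[OF M])
    let ?x = "\<lambda>k::int. of_int k + (\<theta> - t)"
    have "lattice_dist t \<theta> = (\<integral>\<^sup>+ k. ennreal \<bar>W t (?x k) - r.G (?x k)\<bar> \<partial>count_space UNIV)"
      unfolding lattice_dist_eq[OF M t] r.G_eq ..
    also have "\<dots> \<le> (\<integral>\<^sup>+ k. ennreal (W t (?x k)) + ennreal (r.G (?x k)) \<partial>count_space UNIV)"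
    proof (rule nn_integral_mono)
      fix k
      have "\<bar>W t (?x k) - r.G (?x k)\<bar> \<le> W t (?x k) + r.G (?x k)"
        using W_nonneg[OF t, of "?x k"] r.G_nonneg[of "?x k"] by linarith
      then show "ennreal \<bar>W t (?x k) - r.G (?x k)\<bar> \<le> ennreal (W t (?x k)) + ennreal (r.G (?x k))"
        using W_nonneg[OF t, of "?x k"] r.G_nonneg[of "?x k"] by (simp add: ennreal_leI flip: ennreal_plus)
    qed
    also have "\<dots> = (\<integral>\<^sup>+ k. ennreal (W t (?x k)) \<partial>count_space UNIV) + ennreal M"
      by (subst nn_integral_add) (simp_all add: r.total_G)
    also have "\<dots> \<le> m0 \<alpha> h0 \<theta> + m0 \<alpha> h0 \<theta>"
      using mass_le[OF t, of \<theta>] M by (intro add_mono) auto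
    finally show ?thesis .
  qed
qed simp

lemma lattice_dist_tendsto_0:
  assumes fin: "m0 \<alpha> h0 \<theta> \<noteq> \<infinity>"
  shows "((\<lambda>t. lattice_dist t \<theta>) \<longlongrightarrow> 0) at_top"
proof (cases "m0 \<alpha> h0 \<theta> = 0")
  case True
  have "\<forall>\<^sub>F t in at_top. 0 = lattice_dist t \<theta>"
    using eventually_ge_at_top[of 0]
  proof eventually_elim
    case (elim t)
    then show ?case using lattice_dist_le[OF elim, of \<theta>] True by simp
  qed
  then show ?thesis by (rule Lim_transform_eventually[OF tendsto_const])
next
  case False
  with fin obtain M where M: "m0 \<alpha> h0 \<theta> = ennreal M" "0 < M"
    by (cases "m0 \<alpha> h0 \<theta>") (auto simp: less_le)
  interpret r: relaxation \<alpha> h0 h B p \<theta> M "ln M / \<alpha>" by (rule relaxation_at[OF M])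
  have "\<forall>\<^sub>F t in at_top. (\<integral>\<^sup>+ k. ennreal \<bar>W t (of_int k + (\<theta> - t)) - r.G (of_int k + (\<theta> - t))\<bar>
      \<partial>count_space (UNIV :: int set)) = lattice_dist t \<theta>"
    using eventually_ge_at_top[of 0] by eventually_elim (simp only: lattice_dist_eq[OF M] r.G_eq)
  then show ?thesis by (rule Lim_transform_eventually[OF r.lattice_convergence])
qed

text \<open>
  Dominated convergence in \<open>\<theta>\<close>, along sequences of times. Nothing is known about \<open>h\<close> at negative
  times, hence the positive parts.
\<close>

lemma convergence:
  assumes fin: "(\<integral>\<^sup>+ \<theta> \<in> {0<..<1}. m0 \<alpha> h0 \<theta> \<partial>lebesgue) < \<infinity>"
  shows "((\<lambda>t. \<integral>\<^sup>+ x. ennreal (exp (\<alpha> * x) * \<bar>h t x - target t x\<bar>) \<partial>lebesgue) \<longlongrightarrow> 0) at_top"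
proof -
  let ?m = "\<lambda>\<theta>. m0 \<alpha> h0 \<theta> * indicator {0..<1} \<theta>"
  note [measurable] = m0_measurable[OF h0_measurable]
  have ind [measurable]: "(indicator {0..<1} :: real \<Rightarrow> ennreal) \<in> borel_measurable lebesgue"
    by (intro borel_measurable_indicator) simp
  have m_meas [measurable]: "?m \<in> borel_measurable lebesgue" by measurable
  have "AE \<theta> in lebesgue. \<theta> \<noteq> (0::real)" by (rule AE_completion[OF AE_lborel_singleton])
  then have "AE \<theta> in lebesgue. ?m \<theta> = m0 \<alpha> h0 \<theta> * indicator {0<..<1} \<theta>"
    by eventually_elim (auto simp: indicator_def)
  then have "(\<integral>\<^sup>+ \<theta>. ?m \<theta> \<partial>lebesgue) = (\<integral>\<^sup>+ \<theta> \<in> {0<..<1}. m0 \<alpha> h0 \<theta> \<partial>lebesgue)"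
    by (rule nn_integral_cong_AE)
  with fin have m_fin: "(\<integral>\<^sup>+ \<theta>. ?m \<theta> \<partial>lebesgue) < \<infinity>" by simp
  have m_AE: "AE \<theta> in lebesgue. ?m \<theta> \<noteq> \<infinity>"
    by (rule nn_integral_PInf_AE) (use m_fin in auto)
  have "((\<lambda>t. \<integral>\<^sup>+ \<theta> \<in> {0..<1}. lattice_dist (max 0 t) \<theta> \<partial>lebesgue) \<longlongrightarrow> 0) at_top"
  proof (rule tendsto_at_topI_sequentially)
    fix X :: "nat \<Rightarrow> real" assume X: "filterlim X at_top sequentially"
    have X': "filterlim (\<lambda>n. max 0 (X n)) at_top sequentially"
      by (rule filterlim_at_top_mono[OF X]) simp
    have "(\<lambda>n. \<integral>\<^sup>+ \<theta>. lattice_dist (max 0 (X n)) \<theta> * indicator {0..<1} \<theta> \<partial>lebesgue)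
      \<longlonglongrightarrow> (\<integral>\<^sup>+ \<theta>. (0::ennreal) \<partial>(lebesgue :: real measure))"
    proof (rule nn_integral_dominated_convergence[where w = "\<lambda>\<theta>. ?m \<theta> + ?m \<theta>"])
      show "(\<lambda>\<theta>. lattice_dist (max 0 (X n)) \<theta> * indicator {0..<1} \<theta>) \<in> borel_measurable lebesgue" for n
        by (intro borel_measurable_times_ennreal lattice_dist_measurable ind) simp
      show "AE \<theta> in lebesgue. lattice_dist (max 0 (X n)) \<theta> * indicator {0..<1} \<theta> \<le> ?m \<theta> + ?m \<theta>" for n
        using lattice_dist_le[of "max 0 (X n)"] by (auto simp: indicator_def)
      show "(\<integral>\<^sup>+ \<theta>. ?m \<theta> + ?m \<theta> \<partial>lebesgue) < \<infinity>"
        using m_fin by (simp add: nn_integral_add)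
      show "AE \<theta> in lebesgue. (\<lambda>n. lattice_dist (max 0 (X n)) \<theta> * indicator {0..<1} \<theta>) \<longlonglongrightarrow> 0"
        using m_AE
      proof eventually_elim
        case (elim \<theta>)
        show ?case
        proof (cases "\<theta> \<in> {0..<1}")
          case True
          with elim have "m0 \<alpha> h0 \<theta> \<noteq> \<infinity>" by simp
          from filterlim_compose[OF lattice_dist_tendsto_0[OF this] X'] True show ?thesis by simp
        qed simp
      qed
    qed measurable
    then show "(\<lambda>n. \<integral>\<^sup>+ \<theta> \<in> {0..<1}. lattice_dist (max 0 (X n)) \<theta> \<partial>lebesgue) \<longlonglongrightarrow> 0" by simp
  qed
  moreover have "\<forall>\<^sub>F t in at_top. (\<integral>\<^sup>+ \<theta> \<in> {0..<1}. lattice_dist (max 0 t) \<theta> \<partial>lebesgue) =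
      (\<integral>\<^sup>+ x. ennreal (exp (\<alpha> * x) * \<bar>h t x - target t x\<bar>) \<partial>lebesgue)"
    using eventually_ge_at_top[of 0] by eventually_elim (simp add: nn_integral_eq_lattice_dist max_def)
  ultimately show ?thesis by (rule Lim_transform_eventually)
qed

end

text \<open>
  The doubly exponential bound yields both an upper bound for the profile, as \<open>exp (- L * 2 powr x) \<le> 1\<close>, and
  its limit at infinity.
\<close>

lemma stationary_profile_wave:
  assumes \<alpha>: "0 < \<alpha>" and prof: "stationary_profile \<alpha> hb"
  shows "\<exists>B. stationary_wave \<alpha> B hb" and "(hb \<longlongrightarrow> 0) at_top"
proof -
  obtain C L where CL: "0 < C" "0 < L" "\<And>x. 0 < hb x" "\<And>x. hb x \<le> C * exp (- L * 2 powr x)"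
    using prof unfolding stationary_profile_def by blast
  have "stationary_wave \<alpha> C hb"
  proof
    show "0 < \<alpha>" by fact
    fix x
    show "0 \<le> hb x" using CL(3)[of x] by simp
    have "C * exp (- L * 2 powr x) \<le> C * 1" using CL by (intro mult_left_mono) auto
    then show "hb x \<le> C" using CL(4)[of x] by simp
    have "hb differentiable (at x)"
      using prof by (simp add: stationary_profile_def C1_differentiable_on_eq)
    then have "(hb has_real_derivative deriv hb x) (at x)"
      by (simp add: DERIV_deriv_iff_real_differentiable)
    moreover have "0 = deriv hb x + \<alpha> * hb x + exp (- \<alpha>) * (hb (x - 1))\<^sup>2 - (hb x)\<^sup>2"
      using prof unfolding stationary_profile_def by blast
    ultimately show "(hb has_real_derivative (hb x)\<^sup>2 - \<alpha> * hb x - exp (- \<alpha>) * (hb (x - 1))\<^sup>2) (at x)"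
      by (elim DERIV_cong) linarith
  next
    have b: "has_bochner_integral lebesgue (\<lambda>x. exp (\<alpha> * x) * hb x) 1"
      using prof unfolding stationary_profile_def by blast
    have "(\<integral>\<^sup>+ x. ennreal (exp (\<alpha> * x) * hb x) \<partial>lebesgue) = ennreal (\<integral>x. exp (\<alpha> * x) * hb x \<partial>lebesgue)"
      using b CL(3) by (intro nn_integral_eq_integral) (auto simp: has_bochner_integral_iff less_imp_le)
    then show "(\<integral>\<^sup>+ x. ennreal (exp (\<alpha> * x) * hb x) \<partial>lebesgue) = 1"
      using b by (simp add: has_bochner_integral_iff)
  qed
  then show "\<exists>B. stationary_wave \<alpha> B hb" ..
  have "filterlim (\<lambda>x::real. 2 powr x) at_top at_top"
  proof -
    have "filterlim (\<lambda>x. exp (ln 2 * x)) at_top (at_top :: real filter)"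
      by (intro filterlim_compose[OF exp_at_top] filterlim_tendsto_pos_mult_at_top[OF tendsto_const _ filterlim_ident]) simp
    then show ?thesis by (simp add: powr_def mult.commute)
  qed
  then have "filterlim (\<lambda>x. - L * 2 powr x) at_bot at_top"
    using CL(2) by (intro filterlim_tendsto_neg_mult_at_bot[OF tendsto_const]) auto
  then have "((\<lambda>x. C * exp (- L * 2 powr x)) \<longlongrightarrow> 0) at_top"
    by (intro tendsto_mult_right_zero filterlim_compose[OF exp_at_bot])
  then show "(hb \<longlongrightarrow> 0) at_top"
    by (rule tendsto_sandwich[OF _ _ tendsto_const, rotated 2])
      (use CL(3,4) in \<open>auto simp: less_imp_le\<close>)
qed

theorem theorem2p2:
  fixes \<gamma> \<alpha> :: real and h0 hb :: "real \<Rightarrow> real" and h :: "real \<Rightarrow> real \<Rightarrow> real"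
  assumes "\<gamma> < 1" and "\<alpha> = (1 - \<gamma>) * ln 2"
    and "stationary_profile \<alpha> hb"
    and "h0 \<in> borel_measurable lebesgue" and "bounded (range h0)" and "\<And>x. 0 \<le> h0 x"
    and "(\<integral>\<^sup>+ \<theta> \<in> {0<..<1}. m0 \<alpha> h0 \<theta> \<partial>lebesgue) < \<infinity>"
    and "evol_solution \<alpha> h0 h"
  shows "(\<forall>t>0. (\<lambda>x. exp (\<alpha> * x) * \<bar>h t x - profile_ext hb (ereal x - \<mu> \<alpha> h0 t x)\<bar>)
             \<in> borel_measurable lebesgue) \<and>
         ((\<lambda>t. \<integral>\<^sup>+ x. ennreal (exp (\<alpha> * x) * \<bar>h t x - profile_ext hb (ereal x - \<mu> \<alpha> h0 t x)\<bar>)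
             \<partial>lebesgue) \<longlongrightarrow> 0) at_top"
proof -
  have \<alpha>: "0 < \<alpha>" using assms(1,2) by simp
  obtain B where "stationary_wave \<alpha> B hb" using stationary_profile_wave(1)[OF \<alpha> assms(3)] ..
  then interpret stationary_wave \<alpha> B hb .
  interpret evolution_with_wave \<alpha> h0 h B hb
    by unfold_locales (use \<alpha> assms(4,8) stationary_profile_wave(2)[OF \<alpha> assms(3)] in auto)
  show ?thesis
    using integrand_measurable convergence[OF assms(7)] unfolding target_def by simp
qed

end
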